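(* Let $n\ge 3$, $0<m<\frac{n-2}{n}$, $\eta>0$ and let $\alpha,\beta,\rho_1\in\mathbb{R}$ satisfy $$\beta<0,\qquad \rho_1>0,\qquad \alpha=\frac{2\beta-\rho_1}{1-m},\qquad \frac{2}{1-m}<\frac{\alpha}{\beta}<\frac{n-2}{m}.$$ Then there exists a unique radially symmetric (singular) solution $f$ of $$\Delta (f^m/m)+\alpha f+\beta x\cdot\nabla f=0,\qquad f>0,\qquad\text{in }\mathbb{R}^n\setminus\{0\}$$ satisfying $$\lim_{|x|\to 0}|x|^{\alpha/\beta}f(x)=\eta .$$ Moreover $f$ satisfies $$\lim_{|x|\to\infty}|x|^{\frac{n-2}{m}}f(x)=D(\eta)$$ for some constant $D(\eta)>0$.
   Context: Solutions of the elliptic equation are understood in the classical sense (positive and $C^2$ in $\mathbb{R}^n\setminus\{0\}$). *)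

theory Defs
  imports "HOL-Analysis.Analysis"
begin

definition partial :: "'a::euclidean_space \<Rightarrow> ('a \<Rightarrow> real) \<Rightarrow> 'a \<Rightarrow> real" where
  "partial b f x = frechet_derivative f (at x) b"

definition grad :: "('a::euclidean_space \<Rightarrow> real) \<Rightarrow> 'a \<Rightarrow> 'a" where
  "grad f x = (\<Sum>b\<in>Basis. partial b f x *\<^sub>R b)"

definition laplacian :: "('a::euclidean_space \<Rightarrow> real) \<Rightarrow> 'a \<Rightarrow> real" where
  "laplacian f x = (\<Sum>b\<in>Basis. partial b (partial b f) x)"

text \<open>\<open>Ck_on k f S\<close>: \<open>f\<close> is of class \<open>C\<^sup>k\<close> on \<open>S\<close>. Meant for open \<open>S\<close>, since differentiability
  is taken at \<open>x\<close> and not within \<open>S\<close>. The step is equivalent to the usual one for \<open>C\<^sup>k\<close>: a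
  function with continuous partial derivatives is Frechet differentiable.\<close>

primrec Ck_on :: "nat \<Rightarrow> ('a::euclidean_space \<Rightarrow> real) \<Rightarrow> 'a set \<Rightarrow> bool" where
  "Ck_on 0 f S \<longleftrightarrow> continuous_on S f"
| "Ck_on (Suc k) f S \<longleftrightarrow>
     (\<forall>x\<in>S. f differentiable (at x)) \<and> (\<forall>b\<in>Basis. Ck_on k (partial b f) S)"

definition radially_symmetric :: "('a::euclidean_space \<Rightarrow> real) \<Rightarrow> bool" where
  "radially_symmetric f \<longleftrightarrow> (\<exists>g. \<forall>x. x \<noteq> 0 \<longrightarrow> f x = g (norm x))"

text \<open>Classical positive solutions on the punctured space. Functions are total, so the value at
  the origin is arbitrary; none of the conditions depends on it.\<close>

definition elliptic_solution ::
    "real \<Rightarrow> real \<Rightarrow> real \<Rightarrow> ('a::euclidean_space \<Rightarrow> real) \<Rightarrow> bool" where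
  "elliptic_solution m \<alpha> \<beta> f \<longleftrightarrow>
     Ck_on 2 f (- {0}) \<and>
     (\<forall>x. x \<noteq> 0 \<longrightarrow>
        f x > 0 \<and>
        laplacian (\<lambda>y. f y powr m / m) x + \<alpha> * f x + \<beta> * (x \<bullet> grad f x) = 0)"

end

theory Submission
  imports Defs
begin

text \<open>Put \<open>N = n - 2\<close>, \<open>b = - \<beta>\<close>, \<open>\<gamma> = \<alpha> / \<beta>\<close>, \<open>s = ln r\<close>, \<open>F = f\<^sup>m / m\<close>. With
  \<open>z = F' + N F - b r\<^sup>2 f\<close> the radial equation is the system
  \<open>F' = z - N F + b r\<^sup>2 f\<close>, \<open>z' = b (\<gamma> - 2) r\<^sup>2 f\<close>, in which each right-hand side increases
  with the other unknown. A positive solution on the whole line has \<open>z < 0\<close> (otherwise it blows up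
  in finite time) and \<open>z\<close> comes arbitrarily close to \<open>0\<close>. Hence two such solutions that are ordered
  at one point stay ordered to the right of it: once \<open>F\<^sub>1 < F\<^sub>2\<close> sets in, \<open>z\<^sub>1 - z\<^sub>2\<close> is negative
  and decreasing. The equation is invariant under \<open>f \<mapsto> \<lambda>\<^bsup>2/(1-m)\<^esup> f(\<lambda>x)\<close>, which for
  \<open>\<lambda> < 1\<close> increases the limit \<open>\<eta>\<close>; comparing with rescalings and letting \<open>\<lambda> \<rightarrow> 1\<close> gives uniqueness.

  By the same scaling, one global solution with some positive limit at the origin suffices for
  existence. It is built from infinity: \<open>u = r\<^sup>N F\<close>, as a function of \<open>x = r\<^bsup>-\<kappa>\<^esup>\<close> with
  \<open>\<kappa> = (1-m)N/m - 2\<close>, solves a Volterra equation on \<open>[0, \<infinity>)\<close> with \<open>u(0) = 1\<close>, for which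
  Picard iteration converges globally after truncating the nonlinearity. The region
  \<open>p < - F'/F < N\<close>, \<open>p = \<gamma> m\<close>, is invariant, so the truncation is inactive, and a Lyapunov
  function bounds the monotone quantity \<open>r\<^sup>p F\<close> as \<open>r \<rightarrow> 0\<close>.\<close>

text \<open>A positive derivative would force negative values just to the left of \<open>x\<close>.
  This first-exit test serves both the ordering of solutions and the invariance of the
  region.\<close>

lemma DERIV_nonpos_at_exit:
  fixes f :: "real \<Rightarrow> real"
  assumes d: "(f has_real_derivative D) (at x)" and "f x \<le> 0"
    and pos: "\<And>y. a < y \<Longrightarrow> y < x \<Longrightarrow> f y > 0" and "a < x"
  shows "D \<le> 0"
proof (rule ccontr)
  assume "\<not> D \<le> 0"
  then obtain d where "d > 0" and d: "\<And>h. h > 0 \<Longrightarrow> h < d \<Longrightarrow> f (x - h) < f x"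
    using DERIV_pos_inc_left[OF d] by force
  define h where "h = min (d/2) ((x - a)/2)"
  have "h > 0" "h < d" "a < x - h" "x - h < x"
    using \<open>d > 0\<close> \<open>a < x\<close> by (auto simp: h_def min_def field_simps)
  with d[of h] pos[of "x - h"] \<open>f x \<le> 0\<close> show False by simp
qed

section \<open>A Volterra equation with a singular weight\<close>

text \<open>The solution \<open>w\<close> of \<open>x * w' + \<nu> * w = x * h\<close> that vanishes
  at 0. At \<open>x = 0\<close> the integral is over a single point, so the value is 0.\<close>

definition weighted_integral :: "real \<Rightarrow> (real \<Rightarrow> real) \<Rightarrow> real \<Rightarrow> real" where
  "weighted_integral \<nu> h x = x powr (- \<nu>) * integral {0..x} (\<lambda>y. y powr \<nu> * h y)"

lemma powr_mult_continuous:
  fixes h :: "real \<Rightarrow> real"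
  assumes "continuous_on {0..x} h" "\<nu> > 0"
  shows "continuous_on {0..x} (\<lambda>y. y powr \<nu> * h y)"
  using assms by (intro continuous_intros continuous_on_powr') auto

text \<open>Integrating the exponential gains a factor \<open>1 / c\<close>, which for large
  \<open>c\<close> makes the integral operators contractions in a weighted sup norm.\<close>

lemma abs_integral_le_exp:
  fixes h :: "real \<Rightarrow> real"
  assumes "x \<ge> 0" "c > 0" and h: "continuous_on {0..x} h"
    and le: "\<And>y. 0 \<le> y \<Longrightarrow> y \<le> x \<Longrightarrow> \<bar>h y\<bar> \<le> K * exp (c * y)"
  shows "\<bar>integral {0..x} h\<bar> \<le> K * exp (c * x) / c"
proof -
  have K: "K \<ge> 0" using le[of 0] \<open>x \<ge> 0\<close> by simp
  have int: "((\<lambda>y. K * exp (c * y)) has_integral K * exp (c * x) / c - K * exp (c * 0) / c) {0..x}"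
    using assms(1,2)
    by (intro fundamental_theorem_of_calculus)
       (auto intro!: derivative_eq_intros simp flip: has_real_derivative_iff_has_vector_derivative)
  have "norm (integral {0..x} h) \<le> integral {0..x} (\<lambda>y. K * exp (c * y))"
  proof (rule integral_norm_bound_integral)
    show "h integrable_on {0..x}" using h by (rule integrable_continuous_interval)
    show "(\<lambda>y. K * exp (c * y)) integrable_on {0..x}" using int by blast
  qed (use le in auto)
  also have "\<dots> \<le> K * exp (c * x) / c"
    unfolding integral_unique[OF int] using K \<open>c > 0\<close> by simp
  finally show ?thesis by simp
qed

text \<open>The weight \<open>(y / x) powr \<nu>\<close> is at most 1 for \<open>y\<close> in
  \<open>{0..x}\<close>, so the bound for the plain integral carries over.\<close>

lemma weighted_integral_le_exp:
  assumes "x \<ge> 0" "c > 0" "\<nu> > 0" and h: "continuous_on {0..x} h"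
    and le: "\<And>y. 0 \<le> y \<Longrightarrow> y \<le> x \<Longrightarrow> \<bar>h y\<bar> \<le> K * exp (c * y)"
  shows "\<bar>weighted_integral \<nu> h x\<bar> \<le> K * exp (c * x) / c"
proof (cases "x = 0")
  case True
  then show ?thesis using le[of 0] \<open>c > 0\<close> by (simp add: weighted_integral_def)
next
  case False
  have "weighted_integral \<nu> h x = integral {0..x} (\<lambda>y. x powr (- \<nu>) * (y powr \<nu> * h y))"
    by (simp add: weighted_integral_def)
  also have "\<bar>\<dots>\<bar> \<le> K * exp (c * x) / c"
  proof (rule abs_integral_le_exp[OF \<open>x \<ge> 0\<close> \<open>c > 0\<close>])
    show "continuous_on {0..x} (\<lambda>y. x powr (- \<nu>) * (y powr \<nu> * h y))"
      using powr_mult_continuous[OF h \<open>\<nu> > 0\<close>] by (rule continuous_on_mult_left)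
    fix y assume y: "0 \<le> y" "y \<le> x"
    have "x powr (- \<nu>) * y powr \<nu> \<le> x powr (- \<nu>) * x powr \<nu>"
      using y \<open>\<nu> > 0\<close> by (intro mult_left_mono powr_mono2) auto
    also have "\<dots> = 1" using False \<open>x \<ge> 0\<close> by (simp flip: powr_add)
    finally have "(x powr (- \<nu>) * y powr \<nu>) * \<bar>h y\<bar> \<le> 1 * (K * exp (c * y))"
      using le[OF y] by (intro mult_mono) auto
    then show "\<bar>x powr (- \<nu>) * (y powr \<nu> * h y)\<bar> \<le> K * exp (c * y)"
      by (simp add: abs_mult mult.assoc)
  qed
  finally show ?thesis .
qed

lemma integral_from_0_has_derivative:
  fixes h :: "real \<Rightarrow> real"
  assumes h: "continuous_on {0..} h" and "x > 0"
  shows "((\<lambda>x. integral {0..x} h) has_real_derivative h x) (at x)"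
proof -
  have "((\<lambda>x. integral {0..x} h) has_real_derivative h x) (at x within {0..x + 1})"
    using \<open>x > 0\<close> by (intro integral_has_real_derivative continuous_on_subset[OF h]) auto
  moreover have "at x within {0..x + 1} = at x"
    using \<open>x > 0\<close> by (intro at_within_interior) auto
  ultimately show ?thesis by simp
qed

lemma integral_from_0_continuous:
  fixes h :: "real \<Rightarrow> real"
  assumes h: "continuous_on {0..} h"
  shows "continuous_on {0..} (\<lambda>x. integral {0..x} h)"
proof -
  have "continuous (at x within {0..}) (\<lambda>x. integral {0..x} h)" if "x \<ge> 0" for x
  proof -
    have "continuous_on {0..x + 1} (\<lambda>x. integral {0..x} h)"
      by (intro indefinite_integral_continuous_1 integrable_continuous_interval
          continuous_on_subset[OF h]) auto
    then have "continuous (at x within {0..x + 1}) (\<lambda>x. integral {0..x} h)"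
      using that by (auto simp: continuous_on_eq_continuous_within)
    moreover have "at x within {0..} = at x within {0..x + 1}"
      using that by (intro at_within_nhd[of x "{..<x + 1}"]) auto
    ultimately show ?thesis by simp
  qed
  then show ?thesis by (auto simp: continuous_on_eq_continuous_within)
qed

lemma weighted_integral_continuous:
  assumes h: "continuous_on {0..} h" and "\<nu> > 0"
  shows "continuous_on {0..} (weighted_integral \<nu> h)"
proof -
  have ph: "continuous_on {0..} (\<lambda>y. y powr \<nu> * h y)"
    using assms by (intro continuous_intros continuous_on_powr') auto
  have "continuous (at x within {0..}) (weighted_integral \<nu> h)" if "x \<ge> 0" for x
  proof (cases "x = 0")
    case False
    have "isCont (weighted_integral \<nu> h) x"
      unfolding weighted_integral_def
      using that False DERIV_isCont[OF integral_from_0_has_derivative[OF ph, of x]]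
      by (intro continuous_intros) auto
    then show ?thesis by (rule continuous_at_imp_continuous_at_within)
  next
    case True
    have c1: "continuous_on {0..1} h" using h by (rule continuous_on_subset) auto
    obtain K where K: "\<And>y. 0 \<le> y \<Longrightarrow> y \<le> 1 \<Longrightarrow> \<bar>h y\<bar> \<le> K"
      using compact_imp_bounded[OF compact_continuous_image[OF c1 compact_Icc]]
      unfolding bounded_iff by (metis atLeastAtMost_iff imageI real_norm_def)
    have bd: "\<bar>weighted_integral \<nu> h x\<bar> \<le> K * x * exp 1" if x: "0 < x" "x \<le> 1" for x
    proof -
      \<comment> \<open>The rate \<open>c = 1 / x\<close> in the exponential bound yields a bound
        linear in \<open>x\<close>, hence continuity at 0.\<close>
      have "\<bar>weighted_integral \<nu> h x\<bar> \<le> K * exp (1 / x * x) / (1 / x)"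
      proof (rule weighted_integral_le_exp)
        show "continuous_on {0..x} h" using h by (rule continuous_on_subset) auto
        fix y assume y: "0 \<le> y" "y \<le> x"
        have "\<bar>h y\<bar> \<le> K * 1" using K[of y] y x by simp
        also have "\<dots> \<le> K * exp (1 / x * y)"
          using y x K[of 0] by (intro mult_left_mono) auto
        finally show "\<bar>h y\<bar> \<le> K * exp (1 / x * y)" .
      qed (use x \<open>\<nu> > 0\<close> in auto)
      then show ?thesis using x by (simp add: mult_ac)
    qed
    have "(weighted_integral \<nu> h \<longlongrightarrow> 0) (at 0 within {0..})"
    proof (rule Lim_null_comparison)
      have "\<forall>\<^sub>F x in at 0 within {0..}. x < (1::real)"
        by (rule order_tendstoD[OF tendsto_ident_at]) simp
      then show "\<forall>\<^sub>F x in at 0 within {0..}. norm (weighted_integral \<nu> h x) \<le> K * x * exp 1"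
        using bd by (auto simp: eventually_at_filter elim!: eventually_mono)
      show "((\<lambda>x. K * x * exp 1) \<longlongrightarrow> 0) (at 0 within {0..})"
        by (auto intro!: tendsto_eq_intros)
    qed
    then show ?thesis using True by (simp add: continuous_within weighted_integral_def)
  qed
  then show ?thesis by (auto simp: continuous_on_eq_continuous_within)
qed

text \<open>Banach's theorem in the sup norm weighted by \<open>exp (- c * x)\<close>. Since
  \<open>c\<close> may be large compared with the Lipschitz constant, one fixed point covers the
  whole half-line; boundedness of \<open>T\<close> keeps the images bounded.\<close>

lemma Volterra_solution_exists:
  fixes T :: "real \<Rightarrow> real"
  assumes "\<nu> > 0" and Lip: "\<And>x y. \<bar>T x - T y\<bar> \<le> L * \<bar>x - y\<bar>" and bd: "\<And>x. \<bar>T x\<bar> \<le> H"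
  shows "\<exists>u. continuous_on {0..} u \<and>
    (\<forall>x\<ge>0. u x = u0 - A1 * integral {0..x} (T \<circ> u) - A2 * weighted_integral \<nu> (T \<circ> u) x)"
proof -
  define C where "C = \<bar>A1\<bar> + \<bar>A2\<bar>"
  have L: "L \<ge> 0" using order_trans[OF abs_ge_zero Lip[of 1 0]] by simp
  have H: "H \<ge> 0" using bd[of 0] by linarith
  \<comment> \<open>The contraction factor will be \<open>C * L / c\<close>, which is at most 1/2;
    the summand 1 keeps \<open>c\<close> positive when \<open>C * L = 0\<close>.\<close>
  define c where "c = 2 * C * L + 1"
  have c: "c > 0" using L by (simp add: c_def C_def add_nonneg_pos)
  define V where "V h x = A1 * integral {0..x} h + A2 * weighted_integral \<nu> h x" for h x
  have V_le: "\<bar>V h x\<bar> \<le> C * (K * exp (c * x) / c)"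
    if "x \<ge> 0" "continuous_on {0..} h" "\<And>y. 0 \<le> y \<Longrightarrow> \<bar>h y\<bar> \<le> K * exp (c * y)" for h x K
  proof -
    have h: "continuous_on {0..x} h" using that(2) by (rule continuous_on_subset) auto
    have "\<bar>V h x\<bar> \<le> \<bar>A1\<bar> * \<bar>integral {0..x} h\<bar> + \<bar>A2\<bar> * \<bar>weighted_integral \<nu> h x\<bar>"
      unfolding V_def abs_mult[symmetric] by (rule abs_triangle_ineq)
    also have "\<dots> \<le> \<bar>A1\<bar> * (K * exp (c * x) / c) + \<bar>A2\<bar> * (K * exp (c * x) / c)"
      using that c h \<open>\<nu> > 0\<close>
      by (intro add_mono mult_left_mono abs_integral_le_exp weighted_integral_le_exp) auto
    finally show ?thesis unfolding C_def distrib_right .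
  qed
  have V_cont: "continuous_on {0..} (V h)" if "continuous_on {0..} h" for h
    unfolding V_def
    by (intro continuous_intros integral_from_0_continuous weighted_integral_continuous that \<open>\<nu> > 0\<close>)
  have V_diff: "V h x - V k x = V (\<lambda>y. h y - k y) x"
    if "x \<ge> 0" "continuous_on {0..} h" "continuous_on {0..} k" for h k x
  proof -
    have hk: "continuous_on {0..x} h" "continuous_on {0..x} k"
      using that by (auto intro: continuous_on_subset)
    then have "integral {0..x} (\<lambda>y. h y - k y) = integral {0..x} h - integral {0..x} k"
      by (intro integral_diff integrable_continuous_interval)
    moreover have "integral {0..x} (\<lambda>y. y powr \<nu> * h y - y powr \<nu> * k y) =
        integral {0..x} (\<lambda>y. y powr \<nu> * h y) - integral {0..x} (\<lambda>y. y powr \<nu> * k y)"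
      using hk \<open>\<nu> > 0\<close>
      by (intro integral_diff integrable_continuous_interval powr_mult_continuous)
    ultimately show ?thesis by (simp add: V_def weighted_integral_def right_diff_distrib)
  qed
  \<comment> \<open>The unknown is the bounded function \<open>B\<close>, standing for
    \<open>exp (- c * x) * u x\<close>; \<open>U\<close> removes the weight.\<close>
  define U where "U B x = exp (c * x) * apply_bcontfun B x" for B :: "real \<Rightarrow>\<^sub>C real" and x
  have U_cont: "continuous_on A (U B)" for A B
    unfolding U_def by (intro continuous_intros) simp
  have T_cont: "continuous_on A T" for A
  proof -
    have "L-lipschitz_on A T" using Lip L by (auto intro!: lipschitz_onI simp: dist_real_def)
    then show ?thesis by (rule lipschitz_on_continuous_on)
  qed
  have TU: "continuous_on A (T \<circ> U B)" for A B
    by (rule continuous_on_compose[OF U_cont T_cont])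
  \<comment> \<open>Bounded continuous functions live on the whole line, so \<open>max 0 x\<close>
    continues the image constantly to the left of 0.\<close>
  define \<Phi> where "\<Phi> B x = exp (- c * max 0 x) * (u0 - V (T \<circ> U B) (max 0 x))" for B x
  have \<Phi>_bcontfun: "\<Phi> B \<in> bcontfun" for B
  proof (rule bcontfun_normI)
    show "continuous_on UNIV (\<Phi> B)"
      unfolding \<Phi>_def
      by (intro continuous_intros continuous_on_compose2[OF V_cont[OF TU], of UNIV "max 0"]) auto
    fix x :: real
    define t where "t = max 0 x"
    have t: "t \<ge> 0" by (simp add: t_def)
    have "\<bar>V (T \<circ> U B) t\<bar> \<le> C * (H * exp (c * t) / c)"
    proof (rule V_le[OF t TU])
      fix y :: real assume "0 \<le> y"
      then have "H * 1 \<le> H * exp (c * y)" using H c by (intro mult_left_mono) auto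
      then show "\<bar>(T \<circ> U B) y\<bar> \<le> H * exp (c * y)" using bd[of "U B y"] by simp
    qed
    then have "\<bar>u0 - V (T \<circ> U B) t\<bar> \<le> \<bar>u0\<bar> * exp (c * t) + C * (H * exp (c * t) / c)"
      using t c mult_left_mono[of 1 "exp (c * t)" "\<bar>u0\<bar>"] by fastforce
    then have "exp (- c * t) * \<bar>u0 - V (T \<circ> U B) t\<bar> \<le>
        exp (- c * t) * (\<bar>u0\<bar> * exp (c * t) + C * (H * exp (c * t) / c))"
      by (intro mult_left_mono) auto
    also have "\<dots> = \<bar>u0\<bar> + C * H / c" by (simp add: exp_minus field_simps)
    finally show "norm (\<Phi> B x) \<le> \<bar>u0\<bar> + C * H / c"
      by (simp add: \<Phi>_def t_def abs_mult)
  qed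
  define \<Psi> where "\<Psi> B = Bcontfun (\<Phi> B)" for B
  have \<Psi>: "apply_bcontfun (\<Psi> B) x = \<Phi> B x" for B x
    unfolding \<Psi>_def by (simp add: Bcontfun_inverse \<Phi>_bcontfun)
  have "dist (\<Psi> B1) (\<Psi> B2) \<le> 1 / 2 * dist B1 B2" for B1 B2
  proof (rule dist_bound)
    fix x :: real
    define t where "t = max 0 x"
    have t: "t \<ge> 0" by (simp add: t_def)
    have "\<bar>V (\<lambda>y. (T \<circ> U B2) y - (T \<circ> U B1) y) t\<bar> \<le> C * (L * dist B1 B2 * exp (c * t) / c)"
    proof (rule V_le[OF t])
      show "continuous_on {0..} (\<lambda>y. (T \<circ> U B2) y - (T \<circ> U B1) y)"
        by (intro continuous_on_diff TU)
      fix y :: real assume "0 \<le> y"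
      have "\<bar>(T \<circ> U B2) y - (T \<circ> U B1) y\<bar> \<le> L * \<bar>U B2 y - U B1 y\<bar>" using Lip by simp
      also have "\<bar>U B2 y - U B1 y\<bar> = exp (c * y) * dist (B1 y) (B2 y)"
        by (simp add: U_def dist_real_def abs_mult flip: right_diff_distrib)
      also have "L * \<dots> \<le> L * (exp (c * y) * dist B1 B2)"
        using L dist_bounded by (intro mult_left_mono) auto
      finally show "\<bar>(T \<circ> U B2) y - (T \<circ> U B1) y\<bar> \<le> L * dist B1 B2 * exp (c * y)"
        by (simp add: mult_ac)
    qed
    then have "\<bar>V (T \<circ> U B2) t - V (T \<circ> U B1) t\<bar> \<le> C * (L * dist B1 B2 * exp (c * t) / c)"
      using V_diff[OF t TU TU] by simp
    then have "exp (- c * t) * \<bar>V (T \<circ> U B2) t - V (T \<circ> U B1) t\<bar> \<le>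
        exp (- c * t) * (C * (L * dist B1 B2 * exp (c * t) / c))"
      by (intro mult_left_mono) auto
    also have "\<dots> = C * L / c * dist B1 B2" by (simp add: exp_minus field_simps)
    also have "\<dots> \<le> 1 / 2 * dist B1 B2"
      using c by (intro mult_right_mono) (auto simp: c_def field_simps)
    also have "exp (- c * t) * \<bar>V (T \<circ> U B2) t - V (T \<circ> U B1) t\<bar> = dist (\<Phi> B1 x) (\<Phi> B2 x)"
      by (simp add: \<Phi>_def t_def dist_real_def abs_mult flip: right_diff_distrib)
    finally show "dist (\<Psi> B1 x) (\<Psi> B2 x) \<le> 1 / 2 * dist B1 B2" by (simp add: \<Psi>)
  qed
  then obtain B where B: "\<Psi> B = B"
    using banach_fix_type[of "1/2" \<Psi>] by auto
  have "U B x = u0 - V (T \<circ> U B) x" if "x \<ge> 0" for x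
  proof -
    have "U B x = exp (c * x) * \<Phi> B x" by (metis B U_def \<Psi>)
    then show ?thesis using that by (simp add: \<Phi>_def max_def exp_minus)
  qed
  then show ?thesis
    using U_cont by (intro exI[of _ "U B"]) (auto simp: V_def algebra_simps)
qed

section \<open>The monotone system and uniqueness\<close>

locale singular_system =
  fixes N b m \<gamma> :: real
  assumes N_pos: "N > 0" and b_pos: "b > 0" and m_pos: "m > 0" and m_less_1: "m < 1"
    and \<gamma>_lower: "2 / (1 - m) < \<gamma>" and \<gamma>_upper: "\<gamma> < N / m"
begin

definition p where "p = \<gamma> * m"
text \<open>\<open>F powr (1 / m) = F powr a * F\<close>, so \<open>a\<close> measures the
  superlinearity of the system, and \<open>2 / a\<close> is the exponent with which \<open>F\<close>
  scales.\<close>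

definition a where "a = 1 / m - 1"

lemma a_pos: "a > 0"
  using m_pos m_less_1 by (simp add: a_def field_simps)

lemma \<gamma>_gt_2: "\<gamma> > 2"
proof -
  have "2 \<le> 2 / (1 - m)" using m_pos m_less_1 by (simp add: field_simps)
  then show ?thesis using \<gamma>_lower by linarith
qed

text \<open>The upper bound on \<open>\<gamma>\<close> turns into \<open>p < N\<close>, and the
  lower bound into \<open>a * p > 2\<close>, because
  \<open>a * p = (1 - m) * \<gamma>\<close>.\<close>

lemma p_pos: "p > 0" and p_less_N: "p < N" and ap_gt_2: "a * p > 2"
proof -
  show "p > 0" using \<gamma>_gt_2 m_pos by (simp add: p_def)
  show "p < N" using \<gamma>_upper m_pos by (simp add: p_def field_simps)
  have "a * p = (1 - m) * \<gamma>" using m_pos by (simp add: p_def a_def field_simps)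
  then show "a * p > 2" using \<gamma>_lower m_less_1 by (simp add: field_simps)
qed

lemma aN_gt_2: "a * N > 2"
  using ap_gt_2 p_less_N a_pos by (smt (verit) mult_strict_left_mono)

text \<open>Here \<open>(m * F s) powr (1 / m)\<close> is \<open>f\<close> at radius
  \<open>exp s\<close>. Solutions live on the whole line, which is what makes finite-time blow-up a
  contradiction.\<close>

definition sol :: "(real \<Rightarrow> real) \<Rightarrow> (real \<Rightarrow> real) \<Rightarrow> bool" where
  "sol F z \<longleftrightarrow> (\<forall>s. F s > 0 \<and>
     (F has_real_derivative z s - N * F s + b * exp (2 * s) * (m * F s) powr (1 / m)) (at s) \<and>
     (z has_real_derivative b * (\<gamma> - 2) * exp (2 * s) * (m * F s) powr (1 / m)) (at s))"

lemma sol_pos: "sol F z \<Longrightarrow> F s > 0"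
  and sol_F: "sol F z \<Longrightarrow>
    (F has_real_derivative z s - N * F s + b * exp (2 * s) * (m * F s) powr (1 / m)) (at s)"
  and sol_z: "sol F z \<Longrightarrow>
    (z has_real_derivative b * (\<gamma> - 2) * exp (2 * s) * (m * F s) powr (1 / m)) (at s)"
  by (auto simp: sol_def)

lemma sol_z_deriv_pos: "sol F z \<Longrightarrow> b * (\<gamma> - 2) * exp (2 * s) * (m * F s) powr (1 / m) > 0"
  using b_pos \<gamma>_gt_2 m_pos by (auto simp: sol_def dest: spec[of _ s])

lemma sol_z_mono: "sol F z \<Longrightarrow> s < t \<Longrightarrow> z s < z t"
  using DERIV_pos_imp_increasing[of s t z] sol_z sol_z_deriv_pos by blast

lemma sol_continuous:
  assumes "sol F z" shows "continuous_on A F" "continuous_on A z"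
  using sol_F[OF assms] sol_z[OF assms]
  by (meson DERIV_isCont continuous_at_imp_continuous_on)+

text \<open>If \<open>z\<close> were ever nonnegative, then \<open>z\<close> and \<open>F\<close>
  would eventually exceed positive constants. The factor \<open>exp (2 * s)\<close> then lets the
  superlinear term beat \<open>N * F\<close>, leaving an inequality F' >= K F^(1/m) with 1/m > 1,
  which blows up in finite time.\<close>

lemma sol_z_neg:
  assumes S: "sol F z" shows "z s < 0"
proof (rule ccontr)
  assume "\<not> z s < 0"
  \<comment> \<open>One unit further to the right \<open>z\<close> is strictly positive, by strict
    monotonicity.\<close>
  define s1 where "s1 = s + 1"
  define z1 where "z1 = z s1"
  have z1: "z1 > 0" using sol_z_mono[OF S, of s s1] \<open>\<not> z s < 0\<close> by (simp add: s1_def z1_def)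
  have zge: "z t \<ge> z1" if "t \<ge> s1" for t
    using sol_z_mono[OF S, of s1 t] that by (cases "t = s1") (auto simp: z1_def)
  have Fge: "F t \<ge> z1 / N * (1 - exp (- N * (t - s1)))" if "t \<ge> s1" for t
  proof -
    \<comment> \<open>The integrating factor for the inequality F' >= z1 - N F.\<close>
    let ?k = "\<lambda>t. exp (N * (t - s1)) * (F t - z1 / N)"
    have "?k s1 \<le> ?k t"
    proof (rule DERIV_nonneg_imp_nondecreasing[OF that])
      fix x assume x: "s1 \<le> x" "x \<le> t"
      have "(?k has_real_derivative
          exp (N * (x - s1)) * (z x - z1 + b * exp (2 * x) * (m * F x) powr (1 / m))) (at x)"
        using N_pos by (auto intro!: derivative_eq_intros sol_F[OF S] simp: field_simps)
      moreover have "0 \<le> exp (N * (x - s1)) * (z x - z1 + b * exp (2 * x) * (m * F x) powr (1 / m))"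
        using zge[of x] x b_pos by simp
      ultimately show "\<exists>y. (?k has_real_derivative y) (at x) \<and> 0 \<le> y" by blast
    qed
    then have "- (z1 / N) \<le> exp (N * (t - s1)) * (F t - z1 / N)"
      using sol_pos[OF S, of s1] by simp
    then have "exp (- (N * (t - s1))) * (- (z1 / N)) \<le>
        exp (- (N * (t - s1))) * (exp (N * (t - s1)) * (F t - z1 / N))"
      by (intro mult_left_mono) auto
    also have "\<dots> = F t - z1 / N"
      by (simp add: exp_minus)
    finally show ?thesis by (simp add: algebra_simps)
  qed
  \<comment> \<open>The bound \<open>Fge\<close> one unit after \<open>s1\<close>; that bound
    increases with time.\<close>
  define F0 where "F0 = z1 / N * (1 - exp (- N))"
  have F0: "F0 > 0" using z1 N_pos by (simp add: F0_def)
  have FF0: "F t \<ge> F0" if "t \<ge> s1 + 1" for t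
  proof -
    have "exp (- N * (t - s1)) \<le> exp (- N)"
      using that N_pos mult_left_mono[of 1 "t - s1" N] by simp
    then have "F0 \<le> z1 / N * (1 - exp (- N * (t - s1)))"
      using z1 N_pos unfolding F0_def by (intro mult_left_mono) auto
    then show ?thesis using Fge[of t] that by simp
  qed
  define c where "c = b * m powr (1 / m)"
  have c: "c > 0" using b_pos m_pos by (simp add: c_def)
  \<comment> \<open>From a suitable \<open>s3\<close> on, half of the superlinear term dominates
    \<open>N * F\<close>. The other half, with its exponential frozen at \<open>s3\<close>, provides
    \<open>K\<close>.\<close>
  have "filterlim (\<lambda>t. c * F0 powr a / 2 * exp (2 * t)) at_top at_top"
  proof (rule filterlim_tendsto_pos_mult_at_top[OF tendsto_const])
    show "0 < c * F0 powr a / 2" using c F0 by simp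
    show "filterlim (\<lambda>t::real. exp (2 * t)) at_top at_top"
      by (intro filterlim_compose[OF exp_at_top] filterlim_tendsto_pos_mult_at_top[OF tendsto_const])
         (auto intro: filterlim_ident)
  qed
  then have "eventually (\<lambda>t. c * F0 powr a / 2 * exp (2 * t) \<ge> N \<and> t \<ge> s1 + 1) at_top"
    by (auto simp: filterlim_at_top eventually_ge_at_top intro: eventually_conj)
  then obtain s3 where s3: "c * F0 powr a / 2 * exp (2 * s3) \<ge> N" "s3 \<ge> s1 + 1"
    using eventually_happens'[OF trivial_limit_at_top_linorder] by blast
  define K where "K = c / 2 * exp (2 * s3)"
  have K: "K > 0" using c by (simp add: K_def)
  have powsplit: "F t powr (1 / m) = F t powr a * F t" for t
    using sol_pos[OF S, of t] by (simp add: a_def powr_diff)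
  have growth: "z t - N * F t + b * exp (2 * t) * (m * F t) powr (1 / m) \<ge> K * F t powr (1 / m)"
    if "t \<ge> s3" for t
  proof -
    have Fp: "F t > 0" using sol_pos[OF S] .
    have e: "exp (2 * s3) \<le> exp (2 * t)" using that by simp
    have "K * F t powr (1 / m) + N * F t \<le> c * exp (2 * t) * F t powr (1 / m)"
    proof -
      have "N \<le> c * F0 powr a / 2 * exp (2 * s3)" by fact
      also have "\<dots> \<le> c * F t powr a / 2 * exp (2 * s3)"
        using FF0[of t] that s3 F0 c a_pos
        by (intro mult_right_mono divide_right_mono mult_left_mono powr_mono2) auto
      finally have "N * F t \<le> c / 2 * exp (2 * s3) * (F t powr a * F t)"
        using Fp mult_right_mono[of N _ "F t"] by (simp add: algebra_simps)
      then have "K * F t powr (1 / m) + N * F t \<le> c * exp (2 * s3) * F t powr (1 / m)"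
        by (simp add: K_def powsplit algebra_simps)
      also have "\<dots> \<le> c * exp (2 * t) * F t powr (1 / m)"
        using e c by (intro mult_right_mono mult_left_mono) auto
      finally show ?thesis .
    qed
    moreover have "b * exp (2 * t) * (m * F t) powr (1 / m) = c * exp (2 * t) * F t powr (1 / m)"
      using m_pos Fp by (simp add: c_def powr_mult)
    moreover have "z t \<ge> 0" using zge[of t] that s3 z1 by simp
    ultimately show ?thesis by linarith
  qed
  \<comment> \<open>\<open>F powr (- a)\<close> falls at least at the rate \<open>a * K\<close>,
    since \<open>F powr (- a - 1) * F powr (1 / m) = 1\<close>; by this time it would be
    negative.\<close>
  define t where "t = s3 + F s3 powr (- a) / (a * K) + 1"
  have t: "t > s3" using a_pos K by (simp add: t_def add_nonneg_pos)
  let ?k = "\<lambda>s. F s powr (- a) + a * K * s"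
  have "?k t \<le> ?k s3"
  proof (rule DERIV_nonpos_imp_nonincreasing[OF less_imp_le[OF t]])
    fix x assume x: "s3 \<le> x" "x \<le> t"
    let ?d = "z x - N * F x + b * exp (2 * x) * (m * F x) powr (1 / m)"
    have Fp: "F x > 0" using sol_pos[OF S] .
    have "(?k has_real_derivative - a * F x powr (- a - 1) * ?d + a * K) (at x)"
      using Fp by (auto intro!: derivative_eq_intros sol_F[OF S])
    moreover have "F x powr (- a - 1) * ?d \<ge> F x powr (- a - 1) * (K * F x powr (1 / m))"
      using growth x by (intro mult_left_mono) auto
    moreover have "F x powr (- a - 1) * (K * F x powr (1 / m)) = K"
      using Fp by (simp add: a_def flip: powr_add)
    ultimately have "a * (F x powr (- a - 1) * ?d) \<ge> a * K"
      using a_pos by (intro mult_left_mono) auto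
    with \<open>(?k has_real_derivative _) (at x)\<close>
    show "\<exists>y. (?k has_real_derivative y) (at x) \<and> y \<le> 0" by (auto simp: mult.assoc)
  qed
  moreover have "a * K * t = a * K * s3 + F s3 powr (- a) + a * K"
    using a_pos K by (simp add: t_def field_simps)
  moreover have "F t powr (- a) > 0" "a * K > 0"
    using sol_pos[OF S, of t] a_pos K by auto
  ultimately show False by simp
qed

text \<open>In \<open>F - z / (\<gamma> - 2)\<close> the nonlinear terms cancel, so its derivative
  is \<open>z - N * F\<close>. If \<open>z\<close> stayed below \<open>L < 0\<close>, this quantity
  would tend to minus infinity, yet it is positive because \<open>F > 0\<close> and
  \<open>z < 0\<close>.\<close>

lemma sol_z_sup:
  assumes S: "sol F z" and L: "L < 0"
  shows "\<exists>t\<ge>s. z t > L"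
proof (rule ccontr)
  assume "\<not> ?thesis"
  then have zL: "z t \<le> L" if "t \<ge> s" for t using that by force
  let ?k = "\<lambda>t. F t - z t / (\<gamma> - 2) - L * t"
  \<comment> \<open>The time at which the resulting linear upper bound reaches 0.\<close>
  define t where "t = s + (F s - z s / (\<gamma> - 2)) / (- L)"
  have "z s / (\<gamma> - 2) < 0" using sol_z_neg[OF S, of s] \<gamma>_gt_2 by (simp add: divide_neg_pos)
  then have "(F s - z s / (\<gamma> - 2)) / (- L) > 0"
    using sol_pos[OF S, of s] L by (intro divide_pos_pos) auto
  then have t: "t \<ge> s" by (simp add: t_def)
  have "?k t \<le> ?k s"
  proof (rule DERIV_nonpos_imp_nonincreasing[OF t])
    fix x assume x: "s \<le> x" "x \<le> t"
    have "(?k has_real_derivative z x - N * F x - L) (at x)"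
      using \<gamma>_gt_2 by (auto intro!: derivative_eq_intros sol_F[OF S] sol_z[OF S])
    moreover have "z x - N * F x - L \<le> 0"
      using zL[of x] x N_pos sol_pos[OF S, of x] by (smt (verit) mult_pos_pos)
    ultimately show "\<exists>y. (?k has_real_derivative y) (at x) \<and> y \<le> 0" by blast
  qed
  moreover have "L * t = L * s - (F s - z s / (\<gamma> - 2))"
    using L by (simp add: t_def field_simps)
  ultimately have "F t - z t / (\<gamma> - 2) \<le> 0" by simp
  moreover have "z t / (\<gamma> - 2) < 0" using sol_z_neg[OF S, of t] \<gamma>_gt_2 by (simp add: divide_neg_pos)
  ultimately show False using sol_pos[OF S, of t] by simp
qed

text \<open>At the last zero of \<open>D\<close> before a point with \<open>D < 0\<close> one has
  \<open>Z \<le> 0\<close>, and \<open>Z\<close> strictly decreases while \<open>D < 0\<close>. A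
  return of \<open>D\<close> to 0 would need \<open>Z \<ge> 0\<close>, so \<open>D\<close> stays
  negative and \<open>Z\<close> stays below a negative constant. Since \<open>z1\<close> comes
  arbitrarily close to 0, this would make \<open>z2\<close> positive.\<close>

lemma sol_order:
  assumes S1: "sol F1 z1" and S2: "sol F2 z2" and ge: "F1 s' \<ge> F2 s'" and "s' \<le> s"
  shows "F1 s \<ge> F2 s"
proof (rule ccontr)
  assume neg: "\<not> F1 s \<ge> F2 s"
  define D where "D t = F1 t - F2 t" for t
  define Z where "Z t = z1 t - z2 t" for t
  have ltpow: "(m * F1 t) powr (1 / m) < (m * F2 t) powr (1 / m)" if "D t < 0" for t
    using that m_pos sol_pos[OF S1, of t] by (intro powr_less_mono2) (auto simp: D_def)
  have contD: "continuous_on A D" for A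
    unfolding D_def by (intro continuous_intros sol_continuous[OF S1] sol_continuous[OF S2])
  \<comment> \<open>Where the two solutions meet, all terms of the first equation cancel except
    \<open>z\<close>.\<close>
  have D_deriv: "(D has_real_derivative Z t) (at t)" if "D t = 0" for t
    unfolding D_def Z_def using that
    by (auto intro!: derivative_eq_intros sol_F[OF S1] sol_F[OF S2] simp: D_def)
  have Z_dec: "Z t2 < Z t1" if "t1 < t2" and neg: "\<And>t. t1 < t \<Longrightarrow> t < t2 \<Longrightarrow> D t < 0" for t1 t2
  proof (rule DERIV_neg_imp_decreasing_open[OF that(1)])
    show "continuous_on {t1..t2} Z"
      unfolding Z_def by (intro continuous_intros sol_continuous[OF S1] sol_continuous[OF S2])
    fix t assume t: "t1 < t" "t < t2"
    let ?c = "b * (\<gamma> - 2) * exp (2 * t)"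
    have "(Z has_real_derivative ?c * (m * F1 t) powr (1 / m) - ?c * (m * F2 t) powr (1 / m)) (at t)"
      unfolding Z_def by (intro derivative_intros sol_z[OF S1] sol_z[OF S2])
    moreover have "?c * (m * F1 t) powr (1 / m) < ?c * (m * F2 t) powr (1 / m)"
      using ltpow[OF neg[OF t]] b_pos \<gamma>_gt_2 by (intro mult_strict_left_mono) auto
    ultimately show "\<exists>y. (Z has_real_derivative y) (at t) \<and> y < 0" by fastforce
  qed
  have Ds: "D s < 0" "D s' \<ge> 0" using neg ge by (auto simp: D_def)
  have "s' < s" using Ds \<open>s' \<le> s\<close> by (cases "s' = s") auto
  \<comment> \<open>The maximum of this compact set is the last zero of \<open>D\<close> before
    \<open>s\<close>.\<close>
  define A where "A = {s'..s} \<inter> D -` {0..}"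
  have "closed A" unfolding A_def
    by (intro continuous_closed_preimage contD) auto
  moreover have "bounded A"
    by (rule bounded_subset[of "{s'..s}"]) (auto simp: A_def)
  ultimately have "compact A" by (simp add: compact_eq_bounded_closed)
  moreover have "s' \<in> A" using Ds \<open>s' < s\<close> by (simp add: A_def)
  ultimately obtain s1 where s1: "s1 \<in> A" "\<And>t. t \<in> A \<Longrightarrow> t \<le> s1"
    using compact_attains_sup[of A] by blast
  have s1s: "s1 < s" using s1(1) Ds by (cases "s1 = s") (auto simp: A_def)
  have Dneg: "D t < 0" if "s1 < t" "t \<le> s" for t
    using s1(2)[of t] that s1(1) by (auto simp: A_def not_le[symmetric])
  have Ds1: "D s1 = 0"
  proof (rule ccontr)
    assume "D s1 \<noteq> 0"
    then have "D s1 > 0" using s1(1) by (auto simp: A_def)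
    then obtain t where t: "s1 \<le> t" "t \<le> s" "D t = 0"
      using IVT2'[of D s 0 s1] Ds s1s contD by auto
    with Dneg[of t] \<open>D s1 > 0\<close> show False by (cases "t = s1") auto
  qed
  have "Z s1 \<le> 0"
  proof (rule ccontr)
    assume "\<not> Z s1 \<le> 0"
    then obtain d where "d > 0" and d: "\<And>h. h > 0 \<Longrightarrow> h < d \<Longrightarrow> D s1 < D (s1 + h)"
      using DERIV_pos_inc_right[OF D_deriv[OF Ds1]] by force
    define h where "h = min (d / 2) (s - s1)"
    have "h > 0" "h < d" "s1 + h \<le> s" using \<open>d > 0\<close> s1s by (auto simp: h_def min_def)
    with d[of h] Dneg[of "s1 + h"] Ds1 show False by simp
  qed
  then have Zs: "Z s < 0" using Z_dec[OF s1s] Dneg by fastforce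
  \<comment> \<open>At a first return \<open>s2\<close> the exit test for \<open>- D\<close> gives
    \<open>Z s2 \<ge> 0\<close>, but \<open>Z\<close> has decreased from the negative value
    \<open>Z s\<close>.\<close>
  have Dfut: "D t < 0" if "t \<ge> s" for t
  proof (rule ccontr)
    assume "\<not> D t < 0"
    define B where "B = {s..t} \<inter> D -` {0..}"
    have "closed B" unfolding B_def
      by (intro continuous_closed_preimage contD) auto
    moreover have "bounded B"
      by (rule bounded_subset[of "{s..t}"]) (auto simp: B_def)
    ultimately have "compact B" by (simp add: compact_eq_bounded_closed)
    moreover have "t \<in> B" using that \<open>\<not> D t < 0\<close> by (simp add: B_def)
    ultimately obtain s2 where s2: "s2 \<in> B" "\<And>t. t \<in> B \<Longrightarrow> s2 \<le> t"
      using compact_attains_inf[of B] by blast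
    have ss2: "s < s2" using s2(1) Ds by (cases "s2 = s") (auto simp: B_def)
    have neg2: "D t' < 0" if "s \<le> t'" "t' < s2" for t'
      using s2(2)[of t'] that s2(1) by (auto simp: B_def not_le[symmetric])
    have Ds2: "D s2 = 0"
    proof (rule ccontr)
      assume "D s2 \<noteq> 0"
      then have "D s2 > 0" using s2(1) by (auto simp: B_def)
      then obtain t where t: "s \<le> t" "t \<le> s2" "D t = 0"
        using IVT'[of D s 0 s2] Ds ss2 contD by auto
      with neg2[of t] \<open>D s2 > 0\<close> show False by (cases "t = s2") auto
    qed
    have "- Z s2 \<le> 0"
      by (rule DERIV_nonpos_at_exit[OF DERIV_minus[OF D_deriv[OF Ds2]] _ _ ss2])
         (use neg2 Ds2 in auto)
    moreover have "Z s2 < Z s" using Z_dec[OF ss2] neg2 by simp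
    ultimately show False using Zs by simp
  qed
  \<comment> \<open>With \<open>z1 t > Z s\<close> it follows that
    \<open>z2 t = z1 t - Z t > 0\<close>.\<close>
  have "Z t \<le> Z s" if "t \<ge> s" for t
    using Z_dec[of s t] that Dfut by (cases "t = s") fastforce+
  moreover obtain t where t: "t \<ge> s" "z1 t > Z s" using sol_z_sup[OF S1 Zs] by blast
  moreover have "z2 t < 0" using sol_z_neg[OF S2] .
  ultimately show False unfolding Z_def by (smt (verit))
qed

section \<open>Scaling invariance and uniqueness for the system\<close>

lemma sol_scale:
  assumes S: "sol F z"
  shows "sol (\<lambda>s. exp (2 * l / a) * F (s + l)) (\<lambda>s. exp (2 * l / a) * z (s + l))"
proof -
  let ?L = "exp (2 * l / a)"
  \<comment> \<open>Since \<open>1 / m = a + 1\<close>, the power \<open>1 / m\<close> of the factor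
    \<open>exp (2 * l / a)\<close> is this factor times \<open>exp (2 * l)\<close>, which the shift
    of \<open>exp (2 * s)\<close> absorbs.\<close>
  have key: "exp (2 * s) * (m * (?L * F (s + l))) powr (1 / m) =
     ?L * (exp (2 * (s + l)) * (m * F (s + l)) powr (1 / m))" for s
  proof -
    have "?L powr (1 / m) = exp (2 * l / a * (1 / m))" by (simp add: powr_def)
    also have "2 * l / a * (1 / m) = 2 * l / a + 2 * l"
    proof -
      have "1 / m = a + 1" by (simp add: a_def)
      then show ?thesis using a_pos by (simp add: field_simps)
    qed
    finally have L: "?L powr (1 / m) = ?L * exp (2 * l)" by (simp add: exp_add)
    have "(m * (?L * F (s + l))) powr (1 / m) = (?L * (m * F (s + l))) powr (1 / m)"
      by (simp only: mult.left_commute)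
    also have "\<dots> = ?L * exp (2 * l) * (m * F (s + l)) powr (1 / m)"
      using m_pos sol_pos[OF S, of "s + l"] by (subst powr_mult) (auto simp: L)
    finally show ?thesis by (simp add: exp_add distrib_left)
  qed
  have sh: "((\<lambda>s. s + l) has_real_derivative 1) (at s)" for s
    by (auto intro!: derivative_eq_intros)
  note F' = DERIV_chain2[OF sol_F[OF S] sh] and z' = DERIV_chain2[OF sol_z[OF S] sh]
  show ?thesis
    unfolding sol_def
  proof (intro allI conjI)
    fix s
    show "0 < ?L * F (s + l)" using sol_pos[OF S] by simp
    show "((\<lambda>s. ?L * F (s + l)) has_real_derivative
        ?L * z (s + l) - N * (?L * F (s + l)) + b * exp (2 * s) * (m * (?L * F (s + l))) powr (1 / m)) (at s)"
      by (rule DERIV_cong[OF DERIV_cmult[OF F']]) (use key[of s] in \<open>simp add: algebra_simps\<close>)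
    show "((\<lambda>s. ?L * z (s + l)) has_real_derivative
        b * (\<gamma> - 2) * exp (2 * s) * (m * (?L * F (s + l))) powr (1 / m)) (at s)"
      by (rule DERIV_cong[OF DERIV_cmult[OF z']]) (use key[of s] in \<open>simp add: algebra_simps\<close>)
  qed
qed

lemma scaled_limit:
  assumes "((\<lambda>s. exp (p * s) * F s) \<longlongrightarrow> V) at_bot"
  shows "((\<lambda>s. exp (p * s) * (exp (2 * l / a) * F (s + l))) \<longlongrightarrow> exp ((2 / a - p) * l) * V) at_bot"
proof -
  have "filterlim (\<lambda>s. s + l) at_bot at_bot"
    unfolding filterlim_at_bot
  proof
    fix Z show "\<forall>\<^sub>F x in at_bot. x + l \<le> Z"
      using eventually_le_at_bot[of "Z - l"] by eventually_elim simp
  qed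
  from tendsto_mult[OF tendsto_const filterlim_compose[OF assms this]]
  have "((\<lambda>s. exp ((2 / a - p) * l) * (exp (p * (s + l)) * F (s + l))) \<longlongrightarrow> exp ((2 / a - p) * l) * V) at_bot" .
  moreover have "exp ((2 / a - p) * l) * (exp (p * (s + l)) * F (s + l)) =
     exp (p * s) * (exp (2 * l / a) * F (s + l))" for s
    by (simp add: exp_add exp_diff algebra_simps)
  ultimately show ?thesis by simp
qed

text \<open>Strictness is used twice: a shift \<open>l < 0\<close> strictly raises the limit at the
  origin, and every positive limit is reached by some \<open>l\<close>.\<close>

lemma scale_exponent_neg: "2 / a - p < 0"
  using ap_gt_2 a_pos by (simp add: field_simps)

text \<open>For \<open>l < 0\<close> the rescaled \<open>F1\<close> has a strictly larger limit, so
  it exceeds \<open>F2\<close> near minus infinity, and \<open>sol_order\<close> carries this to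
  \<open>s\<close>. Then \<open>l\<close> tends to 0 from the left.\<close>

lemma sol_le:
  assumes S1: "sol F1 z1" and S2: "sol F2 z2" and "V > 0"
    and l1: "((\<lambda>s. exp (p * s) * F1 s) \<longlongrightarrow> V) at_bot"
    and l2: "((\<lambda>s. exp (p * s) * F2 s) \<longlongrightarrow> V) at_bot"
  shows "F2 s \<le> F1 s"
proof -
  have le: "F2 s \<le> exp (2 * l / a) * F1 (s + l)" if "l < 0" for l
  proof -
    have "1 < exp ((2 / a - p) * l)"
      using scale_exponent_neg that by (simp add: mult_neg_neg)
    then have "V < exp ((2 / a - p) * l) * V" using \<open>V > 0\<close> by simp
    then obtain c where c: "V < c" "c < exp ((2 / a - p) * l) * V" using dense by blast
    have "\<forall>\<^sub>F t in at_bot. exp (p * t) * F2 t < c \<and>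
        c < exp (p * t) * (exp (2 * l / a) * F1 (t + l)) \<and> t \<le> s"
      using order_tendstoD(2)[OF l2 c(1)] order_tendstoD(1)[OF scaled_limit[OF l1] c(2)]
        eventually_le_at_bot[of s] by eventually_elim simp
    from eventually_happens'[OF trivial_limit_at_bot_linorder this]
    obtain t where t: "exp (p * t) * F2 t < exp (p * t) * (exp (2 * l / a) * F1 (t + l))" "t \<le> s"
      using less_trans by blast
    then show ?thesis using sol_order[OF sol_scale[OF S1, of l] S2, of t s] by simp
  qed
  have "isCont F1 s" using sol_F[OF S1] DERIV_isCont by blast
  then have "((\<lambda>l. exp (2 * l / a) * F1 (s + l)) \<longlongrightarrow> exp (2 * 0 / a) * F1 s) (at_left 0)"
    using a_pos
    by (intro tendsto_intros filterlim_mono[OF _ order_refl at_le[of "{..<0}" UNIV]])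
       (auto simp: isCont_iff)
  moreover have "\<forall>\<^sub>F l in at_left 0. F2 s \<le> exp (2 * l / a) * F1 (s + l)"
    using le by (auto simp: eventually_at_filter)
  ultimately show ?thesis
    using tendsto_lowerbound[OF _ _ trivial_limit_at_left_real] by fastforce
qed

section \<open>A solution starting at infinity\<close>

text \<open>By \<open>2 - N / m = - N - \<kappa>\<close>, the nonlinear term for
  \<open>F = exp (- N * s) * u\<close> is \<open>exp (- N * s)\<close> times
  \<open>x = exp (- \<kappa> * s)\<close> times a function of \<open>u\<close>. This makes the
  equation for \<open>u\<close> regular at \<open>x = 0\<close>.\<close>

definition \<kappa> where "\<kappa> = a * N - 2"

lemma \<kappa>_pos: "\<kappa> > 0"
  using aN_gt_2 by (simp add: \<kappa>_def)

lemma N_div_m: "N / m = N + \<kappa> + 2"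
  by (simp add: \<kappa>_def a_def field_simps)

lemma \<gamma>_less: "\<gamma> - 2 < N + \<kappa>"
  using \<gamma>_upper N_div_m by linarith

text \<open>On \<open>[0, 1]\<close> this is \<open>b f r\<^bsup>N/m\<^esup>\<close> in terms of \<open>u\<close>; the clamping makes it globally Lipschitz,
  because \<open>1 / m > 1\<close>.\<close>

definition trunc :: "real \<Rightarrow> real" where
  "trunc y = b * m powr (1 / m) * min 1 (max 0 y) powr (1 / m)"

lemma trunc_eq: "0 < y \<Longrightarrow> y \<le> 1 \<Longrightarrow> trunc y = b * (m * y) powr (1 / m)"
  using m_pos by (simp add: trunc_def powr_mult)

lemma trunc_pos: "0 < y \<Longrightarrow> trunc y > 0"
  using b_pos m_pos by (simp add: trunc_def)

text \<open>Clamping does not increase distances, and on \<open>[0, 1]\<close> the slope of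
  \<open>t powr (1 / m)\<close> is at most \<open>1 / m\<close>.\<close>

lemma trunc_lipschitz: "\<bar>trunc x - trunc y\<bar> \<le> b * m powr (1 / m) / m * \<bar>x - y\<bar>"
proof -
  have le: "y powr (1 / m) - x powr (1 / m) \<le> (y - x) / m" if "0 \<le> x" "x < y" "y \<le> 1" for x y :: real
  proof -
    let ?k = "\<lambda>t. t / m - t powr (1 / m)"
    have "?k x < ?k y"
    proof (rule DERIV_pos_imp_increasing_open[OF \<open>x < y\<close>])
      fix t assume t: "x < t" "t < y"
      have "(?k has_real_derivative 1 / m - 1 / m * t powr (1 / m - 1)) (at t)"
        using t that m_pos by (auto intro!: derivative_eq_intros)
      moreover have "t powr (1 / m - 1) < 1"
        using t that a_pos powr_less_mono2[of "1 / m - 1" t 1] by (simp add: a_def)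
      then have "0 < 1 / m - 1 / m * t powr (1 / m - 1)"
        using m_pos divide_strict_right_mono[of "t powr (1 / m - 1)" 1 m] by simp
      ultimately show "\<exists>y. (?k has_real_derivative y) (at t) \<and> 0 < y" by blast
    next
      show "continuous_on {x..y} ?k"
        using that m_pos by (intro continuous_intros continuous_on_powr') auto
    qed
    then show ?thesis by (simp add: diff_divide_distrib)
  qed
  define X Y where "X = min 1 (max 0 x)" and "Y = min 1 (max 0 y)"
  have "\<bar>X powr (1 / m) - Y powr (1 / m)\<bar> \<le> \<bar>X - Y\<bar> / m"
  proof (cases X Y rule: linorder_cases)
    case less
    moreover have "X powr (1 / m) \<le> Y powr (1 / m)"
      using less m_pos by (intro powr_mono2) (auto simp: X_def)
    ultimately show ?thesis using le[of X Y] by (simp add: X_def Y_def)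
  next
    case greater
    moreover have "Y powr (1 / m) \<le> X powr (1 / m)"
      using greater m_pos by (intro powr_mono2) (auto simp: Y_def)
    ultimately show ?thesis using le[of Y X] by (simp add: X_def Y_def)
  qed simp
  also have "\<dots> \<le> \<bar>x - y\<bar> / m"
    using m_pos by (intro divide_right_mono) (auto simp: X_def Y_def)
  finally have "b * m powr (1 / m) * \<bar>X powr (1 / m) - Y powr (1 / m)\<bar> \<le> b * m powr (1 / m) * (\<bar>x - y\<bar> / m)"
    using b_pos by (intro mult_left_mono) auto
  moreover have "trunc x - trunc y = b * m powr (1 / m) * (X powr (1 / m) - Y powr (1 / m))"
    by (simp add: trunc_def X_def Y_def right_diff_distrib)
  ultimately show ?thesis using b_pos by (simp add: abs_mult)
qed

lemma trunc_bound: "\<bar>trunc y\<bar> \<le> b * m powr (1 / m)"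
proof -
  have "min 1 (max 0 y) powr (1 / m) \<le> 1 powr (1 / m)"
    using m_pos by (intro powr_mono2) auto
  then show ?thesis using b_pos m_pos by (simp add: trunc_def abs_mult)
qed

lemma trunc_deriv:
  assumes "0 < w" "w < 1"
  shows "(trunc has_real_derivative trunc w / (m * w)) (at w)"
proof -
  let ?f = "\<lambda>y. b * m powr (1 / m) * y powr (1 / m)"
  have "(?f has_real_derivative b * m powr (1 / m) * (1 / m * w powr (1 / m - 1))) (at w)"
    using assms by (auto intro!: derivative_eq_intros)
  also have "b * m powr (1 / m) * (1 / m * w powr (1 / m - 1)) = trunc w / (m * w)"
    using assms by (simp add: trunc_def powr_diff)
  finally show ?thesis
    by (rule has_field_derivative_transform_within_open[where S = "{0<..<1}"])
       (use assms in \<open>auto simp: trunc_def\<close>)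
qed

lemma trunc_continuous: "continuous_on A trunc"
proof -
  have "(b * m powr (1 / m) / m)-lipschitz_on A trunc"
    using trunc_lipschitz b_pos m_pos by (auto intro!: lipschitz_onI simp: dist_real_def)
  then show ?thesis by (rule lipschitz_on_continuous_on)
qed

text \<open>\<open>\<zeta>\<close> stands for - r^(N + kappa) z. Given \<open>h\<close>, its
  equation is linear, and variation of constants with boundedness at 0 gives \<open>\<zeta>\<close>
  as a weighted integral. Inserting it into the equation for \<open>u\<close> and integrating by
  parts leaves a Volterra equation for \<open>u\<close> alone.\<close>

lemma profile_exists:
  "\<exists>u \<zeta>. continuous_on {0..} u \<and> u 0 = 1 \<and>
     (\<forall>x>0. (u has_real_derivative (\<zeta> x - trunc (u x)) / \<kappa>) (at x)) \<and>
     (\<forall>x>0. (\<zeta> has_real_derivative ((\<gamma> - 2) * trunc (u x) - (N + \<kappa>) * \<zeta> x) / (\<kappa> * x)) (at x)) \<and>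
     (\<zeta> \<longlongrightarrow> (\<gamma> - 2) / (N + \<kappa>) * trunc 1) (at_right 0)"
proof -
  \<comment> \<open>Homogeneous solutions of the equation for \<open>\<zeta>\<close> are multiples
    of \<open>x powr (- \<nu> - 1)\<close>; \<open>A1\<close> and \<open>A2\<close> come from the
    integration by parts.\<close>
  define \<nu> where "\<nu> = N / \<kappa>"
  have \<nu>: "\<nu> > 0" using N_pos \<kappa>_pos by (simp add: \<nu>_def)
  define A2 where "A2 = (\<gamma> - 2) / (N * \<kappa>)"
  define A1 where "A1 = 1 / \<kappa> - A2"
  obtain u where u: "continuous_on {0..} u"
    and ueq: "\<And>x. x \<ge> 0 \<Longrightarrow>
      u x = 1 - A1 * integral {0..x} (trunc \<circ> u) - A2 * weighted_integral \<nu> (trunc \<circ> u) x"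
    using Volterra_solution_exists[OF \<nu> trunc_lipschitz trunc_bound, of 1 A1 A2] by blast
  define h where "h = trunc \<circ> u"
  have h: "continuous_on {0..} h"
    unfolding h_def by (rule continuous_on_compose[OF u trunc_continuous])
  define J where "J x = integral {0..x} (\<lambda>y. y powr \<nu> * h y)" for x
  have Jcont: "continuous_on {0..} (\<lambda>y. y powr \<nu> * h y)"
    using h \<nu> by (intro continuous_intros continuous_on_powr') auto
  have J: "(J has_real_derivative x powr \<nu> * h x) (at x)" if "x > 0" for x
    unfolding J_def using integral_from_0_has_derivative[OF Jcont that] by simp
  define K where "K = (\<gamma> - 2) / \<kappa>"
  define \<zeta> where "\<zeta> x = K * (x powr (- \<nu> - 1) * J x)" for x
  have u': "(u has_real_derivative (\<zeta> x - h x) / \<kappa>) (at x)" if x: "x > 0" for x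
  proof -
    have "((\<lambda>x. 1 - A1 * integral {0..x} h - A2 * (x powr (- \<nu>) * J x)) has_real_derivative
        - A1 * h x - A2 * (- \<nu> * x powr (- \<nu> - 1) * J x + x powr (- \<nu>) * (x powr \<nu> * h x))) (at x)"
      using x by (auto intro!: derivative_eq_intros J integral_from_0_has_derivative[OF h])
    also have "x powr (- \<nu>) * (x powr \<nu> * h x) = h x"
      using x by (simp add: powr_minus)
    also have "- A1 * h x - A2 * (- \<nu> * x powr (- \<nu> - 1) * J x + h x) =
        A2 * \<nu> * x powr (- \<nu> - 1) * J x - (A1 + A2) * h x"
      by (simp add: algebra_simps)
    also have "A1 + A2 = 1 / \<kappa>" by (simp add: A1_def)
    also have "A2 * \<nu> = K / \<kappa>"
      using N_pos by (simp add: A2_def \<nu>_def K_def)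
    also have "K / \<kappa> * x powr (- \<nu> - 1) * J x - 1 / \<kappa> * h x = (\<zeta> x - h x) / \<kappa>"
      by (simp add: \<zeta>_def diff_divide_distrib)
    finally show ?thesis
    proof (rule has_field_derivative_transform_within_open[where S = "{0<..}"])
      fix y :: real assume "y \<in> {0<..}"
      then show "1 - A1 * integral {0..y} h - A2 * (y powr (- \<nu>) * J y) = u y"
        using ueq[of y] by (simp add: weighted_integral_def J_def h_def)
    qed (use x in auto)
  qed
  have \<zeta>': "(\<zeta> has_real_derivative ((\<gamma> - 2) * h x - (N + \<kappa>) * \<zeta> x) / (\<kappa> * x)) (at x)"
    if x: "x > 0" for x
  proof -
    have "(\<zeta> has_real_derivative
        K * ((- \<nu> - 1) * x powr (- \<nu> - 1 - 1) * J x + x powr (- \<nu> - 1) * (x powr \<nu> * h x))) (at x)"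
      unfolding \<zeta>_def
      using x by (auto intro!: derivative_eq_intros J)
    also have "x powr (- \<nu> - 1 - 1) = x powr (- \<nu> - 1) / x" using x by (subst powr_diff) simp
    also have "x powr (- \<nu> - 1) * (x powr \<nu> * h x) = h x / x"
      using x by (simp add: powr_diff powr_minus field_simps)
    also have "K * ((- \<nu> - 1) * (x powr (- \<nu> - 1) / x) * J x + h x / x) =
        K * h x / x - (\<nu> + 1) * \<zeta> x / x"
      using x by (simp add: \<zeta>_def field_simps)
    also have "\<nu> + 1 = (N + \<kappa>) / \<kappa>" using \<kappa>_pos by (simp add: \<nu>_def field_simps)
    finally show ?thesis by (simp add: K_def diff_divide_distrib[of "(\<gamma> - 2) * h x"])
  qed
  \<comment> \<open>By l'Hopital's rule: the quotient of the derivatives is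
    \<open>h x / (\<nu> + 1)\<close>, and \<open>h 0 = trunc 1\<close> since
    \<open>u 0 = 1\<close>.\<close>
  have "((\<lambda>x. J x / x powr (\<nu> + 1)) \<longlongrightarrow> trunc 1 / (\<nu> + 1)) (at_right 0)"
  proof (rule lhopital_right_0)
    have "continuous_on {0..} J"
      unfolding J_def by (rule integral_from_0_continuous[OF Jcont])
    then have "(J \<longlongrightarrow> J 0) (at 0 within {0..})" by (simp add: continuous_on_def)
    then have "(J \<longlongrightarrow> J 0) (at_right 0)" by (rule tendsto_within_subset) auto
    then show "(J \<longlongrightarrow> 0) (at_right 0)" by (simp add: J_def)
    show "((\<lambda>x. x powr (\<nu> + 1)) \<longlongrightarrow> 0) (at_right 0)"
    proof (rule tendsto_eq_rhs)
      show "((\<lambda>x::real. x powr (\<nu> + 1)) \<longlongrightarrow> 0 powr (\<nu> + 1)) (at_right 0)"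
        using \<nu> by (intro tendsto_powr' tendsto_const tendsto_ident_at)
          (auto simp: eventually_at_filter)
    qed simp
    show "\<forall>\<^sub>F x in at_right 0. x powr (\<nu> + 1) \<noteq> 0"
      by (auto simp: eventually_at_filter)
    show "\<forall>\<^sub>F x in at_right 0. (\<nu> + 1) * x powr \<nu> \<noteq> 0"
      using \<nu> by (auto simp: eventually_at_filter)
    show "\<forall>\<^sub>F x in at_right 0. (J has_real_derivative x powr \<nu> * h x) (at x)"
      using J by (auto simp: eventually_at_filter)
    show "\<forall>\<^sub>F x in at_right 0. ((\<lambda>x. x powr (\<nu> + 1)) has_real_derivative (\<nu> + 1) * x powr \<nu>) (at x)"
      by (auto intro!: eventually_at_right_less[THEN eventually_mono] derivative_eq_intros)
    have "(h \<longlongrightarrow> h 0) (at 0 within {0..})" using h by (simp add: continuous_on_def)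
    then have "(h \<longlongrightarrow> h 0) (at_right 0)" by (rule tendsto_within_subset) auto
    then have "((\<lambda>x. h x / (\<nu> + 1)) \<longlongrightarrow> h 0 / (\<nu> + 1)) (at_right 0)"
      using \<nu> by (intro tendsto_intros) auto
    moreover have "h 0 = trunc 1" using ueq[of 0] by (simp add: h_def weighted_integral_def)
    moreover have "\<forall>\<^sub>F x in at_right 0. h x / (\<nu> + 1) = x powr \<nu> * h x / ((\<nu> + 1) * x powr \<nu>)"
      by (auto simp: eventually_at_filter)
    ultimately show "((\<lambda>x. x powr \<nu> * h x / ((\<nu> + 1) * x powr \<nu>)) \<longlongrightarrow> trunc 1 / (\<nu> + 1)) (at_right 0)"
      using Lim_transform_eventually by fastforce
  qed
  from tendsto_mult[OF tendsto_const[of K] this]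
  have "((\<lambda>x. K * (J x / x powr (\<nu> + 1))) \<longlongrightarrow> K * (trunc 1 / (\<nu> + 1))) (at_right 0)" .
  moreover have "K * (J x / x powr (\<nu> + 1)) = \<zeta> x" for x
    using powr_minus_divide[of x "\<nu> + 1"] by (simp add: \<zeta>_def)
  moreover have "\<kappa> * (\<nu> + 1) = N + \<kappa>" using \<kappa>_pos by (simp add: \<nu>_def field_simps)
  then have "K * (trunc 1 / (\<nu> + 1)) = (\<gamma> - 2) / (N + \<kappa>) * trunc 1" by (simp add: K_def)
  ultimately have "(\<zeta> \<longlongrightarrow> (\<gamma> - 2) / (N + \<kappa>) * trunc 1) (at_right 0)" by simp
  moreover have "u 0 = 1" using ueq[of 0] by (simp add: weighted_integral_def)
  ultimately show ?thesis
    using u u' \<zeta>' by (intro exI[of _ u] exI[of _ \<zeta>]) (simp add: h_def)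
qed

end

section \<open>The invariant region along the profile\<close>

locale singular_profile = singular_system +
  fixes u \<zeta> :: "real \<Rightarrow> real"
  assumes u_cont: "continuous_on {0..} u" and u_0: "u 0 = 1"
    and u_trunc: "\<And>x. x > 0 \<Longrightarrow> (u has_real_derivative (\<zeta> x - trunc (u x)) / \<kappa>) (at x)"
    and \<zeta>_trunc: "\<And>x. x > 0 \<Longrightarrow>
      (\<zeta> has_real_derivative ((\<gamma> - 2) * trunc (u x) - (N + \<kappa>) * \<zeta> x) / (\<kappa> * x)) (at x)"
    and \<zeta>_lim: "(\<zeta> \<longlongrightarrow> (\<gamma> - 2) / (N + \<kappa>) * trunc 1) (at_right 0)"
begin

definition h where "h x = trunc (u x)"
text \<open>In terms of the solution, \<open>g > 0\<close> says \<open>- F'/F < N\<close> and \<open>E > 0\<close> says \<open>- F'/F > p\<close>.\<close>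

definition g where "g x = h x - \<zeta> x"
definition E where "E x = (N - p) * u x - x * g x"

lemma u_deriv: "x > 0 \<Longrightarrow> (u has_real_derivative - g x / \<kappa>) (at x)"
  using u_trunc[of x] by (simp add: g_def h_def)

lemma h_deriv:
  assumes "x > 0" "0 < u x" "u x < 1"
  shows "(h has_real_derivative - (h x * g x / (m * \<kappa> * u x))) (at x)"
  unfolding h_def
  using DERIV_chain2[OF trunc_deriv[OF assms(2,3)] u_deriv[OF assms(1)]]
  by (simp add: h_def mult_ac)

text \<open>The coefficient \<open>N + \<kappa> - (\<gamma> - 2)\<close> is positive because
  \<open>\<gamma> < N / m\<close>, so with \<open>h > 0\<close> the derivative is positive wherever
  \<open>g \<le> 0\<close>.\<close>

lemma g_deriv:
  assumes "x > 0" "0 < u x" "u x < 1"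
  shows "(g has_real_derivative
      ((N + \<kappa> - (\<gamma> - 2)) * h x - (N + \<kappa>) * g x) / (\<kappa> * x) - h x * g x / (m * \<kappa> * u x)) (at x)"
proof -
  have "(g has_real_derivative - (h x * g x / (m * \<kappa> * u x)) -
      ((\<gamma> - 2) * trunc (u x) - (N + \<kappa>) * \<zeta> x) / (\<kappa> * x)) (at x)"
    unfolding g_def[abs_def] using DERIV_diff[OF h_deriv[OF assms] \<zeta>_trunc[OF assms(1)]]
    by (simp add: g_def)
  also have "(\<gamma> - 2) * trunc (u x) - (N + \<kappa>) * \<zeta> x =
      - ((N + \<kappa> - (\<gamma> - 2)) * h x - (N + \<kappa>) * g x)"
    by (simp add: g_def h_def algebra_simps)
  finally show ?thesis unfolding minus_divide_left[symmetric] by simp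
qed

text \<open>Arranged as the source \<open>p * g x / \<kappa>\<close> minus a multiple of
  \<open>E\<close>, so that for \<open>g > 0\<close> and \<open>h > 0\<close> the derivative is
  positive wherever \<open>E \<le> 0\<close>.\<close>

lemma E_deriv:
  assumes "x > 0" "0 < u x" "u x < 1"
  shows "(E has_real_derivative p * g x / \<kappa> - h x * E x / (m * \<kappa> * u x)) (at x)"
proof -
  \<comment> \<open>This identity, a consequence of \<open>N / m = N + \<kappa> + 2\<close> and
    \<open>p = \<gamma> * m\<close>, is what turns the bracket below into
    \<open>E x\<close>.\<close>
  have eps: "m * (N + \<kappa> - (\<gamma> - 2)) = N - p"
  proof -
    have "m * (N / m) = N" using m_pos by simp
    then show ?thesis unfolding N_div_m by (simp add: p_def algebra_simps)
  qed
  let ?g' = "((N + \<kappa> - (\<gamma> - 2)) * h x - (N + \<kappa>) * g x) / (\<kappa> * x) - h x * g x / (m * \<kappa> * u x)"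
  have "(E has_real_derivative (N - p) * (- g x / \<kappa>) - (1 * g x + ?g' * x)) (at x)"
    unfolding E_def by (intro DERIV_diff DERIV_cmult DERIV_mult DERIV_ident u_deriv g_deriv assms)
  also have "(N - p) * (- g x / \<kappa>) - (1 * g x + ?g' * x) =
      p * g x / \<kappa> - h x * (m * (N + \<kappa> - (\<gamma> - 2)) * u x - x * g x) / (m * \<kappa> * u x)"
    using assms m_pos \<kappa>_pos by (simp add: field_simps)
  also have "m * (N + \<kappa> - (\<gamma> - 2)) * u x - x * g x = E x" by (simp add: eps E_def)
  finally show ?thesis .
qed

text \<open>At 0 the limit of \<open>E\<close> is \<open>N - p\<close>, and that of \<open>g\<close>
  is \<open>trunc 1\<close> times \<open>1 - (\<gamma> - 2) / (N + \<kappa>)\<close>; both are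
  positive.\<close>

lemma near_0: "\<forall>\<^sub>F x in at_right 0. g x > 0 \<and> E x > 0"
proof -
  have "(u \<longlongrightarrow> u 0) (at 0 within {0..})" using u_cont by (simp add: continuous_on_def)
  then have u: "(u \<longlongrightarrow> 1) (at_right 0)" unfolding u_0 by (rule tendsto_within_subset) auto
  have "isCont trunc 1" using trunc_continuous[of UNIV] by (simp add: continuous_on_eq_continuous_at)
  then have h: "(h \<longlongrightarrow> trunc 1) (at_right 0)"
    unfolding h_def using u by (rule isCont_tendsto_compose)
  have g: "(g \<longlongrightarrow> trunc 1 - (\<gamma> - 2) / (N + \<kappa>) * trunc 1) (at_right 0)"
    unfolding g_def by (intro tendsto_intros h \<zeta>_lim)
  have "((\<lambda>x. (N - p) * u x - x * g x) \<longlongrightarrow>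
      (N - p) * 1 - 0 * (trunc 1 - (\<gamma> - 2) / (N + \<kappa>) * trunc 1)) (at_right 0)"
    by (intro tendsto_intros u g)
  then have E: "(E \<longlongrightarrow> N - p) (at_right 0)" by (simp add: E_def[abs_def])
  have "(\<gamma> - 2) / (N + \<kappa>) < 1" using \<gamma>_less \<gamma>_gt_2 by (simp add: field_simps)
  then have "(\<gamma> - 2) / (N + \<kappa>) * trunc 1 < 1 * trunc 1"
    using trunc_pos[of 1] by (intro mult_strict_right_mono) auto
  then have "\<forall>\<^sub>F x in at_right 0. g x > 0" by (intro order_tendstoD(1)[OF g]) simp
  moreover have "\<forall>\<^sub>F x in at_right 0. E x > 0"
    using p_less_N by (intro order_tendstoD(1)[OF E]) simp
  ultimately show ?thesis by eventually_elim simp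
qed

text \<open>\<open>g > 0\<close> makes \<open>u\<close> decrease from 1, while \<open>E > 0\<close>
  makes \<open>x powr ((N - p) / \<kappa>) * u x\<close> increase, so \<open>u\<close> cannot reach
  0.\<close>

lemma u_range_step:
  assumes "x > 0" and pos: "\<And>y. 0 < y \<Longrightarrow> y < x \<Longrightarrow> g y > 0 \<and> E y > 0"
  shows "0 < u x \<and> u x < 1"
proof
  have upos: "u y > 0" if "0 < y" "y < x" for y
  proof -
    have "(N - p) * u y > 0" using pos[OF that] that by (simp add: E_def) (smt (verit) mult_pos_pos)
    then show ?thesis using p_less_N by (simp add: zero_less_mult_iff)
  qed
  have "u x < u 0"
  proof (rule DERIV_neg_imp_decreasing_open[OF \<open>x > 0\<close>])
    show "continuous_on {0..x} u" using u_cont by (rule continuous_on_subset) auto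
    show "\<exists>D. (u has_real_derivative D) (at y) \<and> D < 0" if "0 < y" "y < x" for y
      using u_deriv[OF that(1)] pos[OF that] \<kappa>_pos by (intro exI[of _ "- g y / \<kappa>"]) auto
  qed
  then show "u x < 1" by (simp add: u_0)
  define c where "c = (N - p) / \<kappa>"
  let ?k = "\<lambda>y. y powr c * u y"
  have "?k (x / 2) < ?k x"
  proof (rule DERIV_pos_imp_increasing_open[of "x / 2" x ?k])
    show "x / 2 < x" using \<open>x > 0\<close> by simp
    show "continuous_on {x / 2..x} ?k"
      using \<open>x > 0\<close> by (intro continuous_intros continuous_on_subset[OF u_cont]) auto
    fix y assume y: "x / 2 < y" "y < x"
    then have "y > 0" using \<open>x > 0\<close> by simp
    have "(?k has_real_derivative c * y powr (c - 1) * u y + (- g y / \<kappa>) * y powr c) (at y)"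
      using \<open>y > 0\<close> by (auto intro!: derivative_eq_intros u_deriv)
    also have "c * y powr (c - 1) * u y + (- g y / \<kappa>) * y powr c = y powr c / (\<kappa> * y) * E y"
    proof -
      have "y powr (c - 1) = y powr c / y" using \<open>y > 0\<close> by (simp add: powr_diff)
      then show ?thesis
        using \<open>y > 0\<close> \<kappa>_pos by (simp add: E_def) (simp add: c_def field_simps)
    qed
    finally have "(?k has_real_derivative y powr c / (\<kappa> * y) * E y) (at y)" .
    moreover have "y powr c / (\<kappa> * y) * E y > 0" using \<open>y > 0\<close> \<kappa>_pos pos[of y] y by simp
    ultimately show "\<exists>D. (?k has_real_derivative D) (at y) \<and> 0 < D" by blast
  qed
  moreover have "?k (x / 2) > 0" using \<open>x > 0\<close> upos[of "x / 2"] by simp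
  ultimately show "u x > 0" using \<open>x > 0\<close> by (smt (verit) powr_gt_zero zero_less_mult_pos)
qed

text \<open>The exit test contradicts the signs in \<open>g_deriv\<close> and
  \<open>E_deriv\<close>. The case of \<open>g\<close> comes first because the source in
  \<open>E_deriv\<close> needs \<open>g > 0\<close>.\<close>

lemma invariant_step:
  assumes "x > 0" and pos: "\<And>y. 0 < y \<Longrightarrow> y < x \<Longrightarrow> g y > 0 \<and> E y > 0"
  shows "g x > 0 \<and> E x > 0"
proof -
  have u: "0 < u x" "u x < 1" using u_range_step[OF assms] by auto
  have hpos: "h x > 0" using u by (simp add: h_def trunc_pos)
  have "g x > 0"
  proof (rule ccontr)
    assume "\<not> g x > 0"
    then have gx: "g x \<le> 0" by simp
    then have "((N + \<kappa> - (\<gamma> - 2)) * h x - (N + \<kappa>) * g x) / (\<kappa> * x) - h x * g x / (m * \<kappa> * u x) \<le> 0"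
      using pos by (intro DERIV_nonpos_at_exit[OF g_deriv[OF \<open>x > 0\<close> u] _ _ \<open>x > 0\<close>]) auto
    moreover have "(N + \<kappa>) * g x \<le> 0" "h x * g x / (m * \<kappa> * u x) \<le> 0"
      using gx hpos N_pos \<kappa>_pos m_pos u
      by (auto simp: mult_nonneg_nonpos intro!: divide_nonpos_pos mult_pos_pos)
    moreover have "(N + \<kappa> - (\<gamma> - 2)) * h x > 0" using \<gamma>_less hpos by simp
    ultimately show False
      using \<kappa>_pos \<open>x > 0\<close> divide_pos_pos[of "(N + \<kappa> - (\<gamma> - 2)) * h x - (N + \<kappa>) * g x" "\<kappa> * x"]
        mult_pos_pos[of \<kappa> x]
      by linarith
  qed
  moreover have "E x > 0"
  proof (rule ccontr)
    assume "\<not> E x > 0"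
    then have Ex: "E x \<le> 0" by simp
    then have "p * g x / \<kappa> - h x * E x / (m * \<kappa> * u x) \<le> 0"
      using pos by (intro DERIV_nonpos_at_exit[OF E_deriv[OF \<open>x > 0\<close> u] _ _ \<open>x > 0\<close>]) auto
    moreover have "h x * E x / (m * \<kappa> * u x) \<le> 0"
      using Ex hpos \<kappa>_pos m_pos u by (auto simp: mult_nonneg_nonpos intro!: divide_nonpos_pos mult_pos_pos)
    moreover have "p * g x / \<kappa> > 0" using \<open>g x > 0\<close> p_pos \<kappa>_pos by simp
    ultimately show False by simp
  qed
  ultimately show ?thesis ..
qed

text \<open>The set of bad points stays away from 0 by \<open>near_0\<close>. Its infimum is good by
  \<open>invariant_step\<close>, and by continuity so are the points just after it, which
  contradicts its being the infimum.\<close>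

lemma invariant: "x > 0 \<Longrightarrow> g x > 0 \<and> E x > 0"
proof (rule ccontr)
  assume "x > 0" and bad: "\<not> (g x > 0 \<and> E x > 0)"
  define S where "S = {y. y > 0 \<and> \<not> (g y > 0 \<and> E y > 0)}"
  obtain \<delta> where \<delta>: "\<delta> > 0" "\<And>y. 0 < y \<Longrightarrow> y < \<delta> \<Longrightarrow> g y > 0 \<and> E y > 0"
    using near_0 by (auto simp: eventually_at_right_field)
  have lower: "\<delta> \<le> y" if "y \<in> S" for y
    using \<delta>(2)[of y] that by (force simp: S_def not_less)
  have ne: "S \<noteq> {}" using \<open>x > 0\<close> bad by (auto simp: S_def)
  have bdd: "bdd_below S" using lower by (rule bdd_belowI)
  define x1 where "x1 = Inf S"
  have x1: "x1 > 0" using cInf_greatest[OF ne lower] \<delta>(1) by (simp add: x1_def)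
  have good: "g y > 0 \<and> E y > 0" if "0 < y" "y < x1" for y
    using cInf_lower[OF _ bdd, of y] that by (force simp: S_def x1_def)
  have u: "0 < u x1" "u x1 < 1" using u_range_step[OF x1 good] by auto
  have "isCont g x1" "isCont E x1"
    using g_deriv[OF x1 u] E_deriv[OF x1 u] DERIV_isCont by blast+
  then have lim: "(g \<longlongrightarrow> g x1) (at x1)" "(E \<longlongrightarrow> E x1) (at x1)" by (simp_all add: isCont_def)
  have gE: "g x1 > 0" "E x1 > 0" using invariant_step[OF x1 good] by auto
  have "\<forall>\<^sub>F y in at x1. g y > 0 \<and> E y > 0"
    using order_tendstoD(1)[OF lim(1) gE(1)] order_tendstoD(1)[OF lim(2) gE(2)]
    by eventually_elim simp
  then obtain d where d: "d > 0" "\<And>y. y \<noteq> x1 \<Longrightarrow> dist y x1 < d \<Longrightarrow> g y > 0 \<and> E y > 0"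
    by (auto simp: eventually_at)
  have "x1 + d \<le> y" if "y \<in> S" for y
  proof (rule ccontr)
    assume "\<not> x1 + d \<le> y"
    moreover have "x1 \<le> y" using cInf_lower[OF that bdd] by (simp add: x1_def)
    moreover have "y \<noteq> x1" using that gE by (auto simp: S_def)
    ultimately show False using d(2)[of y] that by (auto simp: S_def dist_real_def)
  qed
  then have "x1 + d \<le> Inf S" by (rule cInf_greatest[OF ne])
  then show False using d(1) by (simp add: x1_def)
qed

lemma g_pos: "x > 0 \<Longrightarrow> g x > 0" and E_pos: "x > 0 \<Longrightarrow> E x > 0"
  using invariant by auto

lemma u_pos: "x > 0 \<Longrightarrow> u x > 0" and u_less_1: "x > 0 \<Longrightarrow> u x < 1"
  using u_range_step[of x] invariant by auto

lemma h_pos: "x > 0 \<Longrightarrow> h x > 0"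
  by (simp add: h_def trunc_pos u_pos)

section \<open>Convergence of r^p F at the origin; in the variable x this function is
  \<open>v\<close>\<close>

definition v where "v x = x powr ((N - p) / \<kappa>) * u x"

lemma v_pos: "x > 0 \<Longrightarrow> v x > 0"
  by (simp add: v_def u_pos)

lemma ln_v_deriv:
  assumes "x > 0"
  shows "((\<lambda>x. ln (v x)) has_real_derivative E x / (\<kappa> * x * u x)) (at x)"
proof -
  have "((\<lambda>x. (N - p) / \<kappa> * ln x + ln (u x)) has_real_derivative
      (N - p) / \<kappa> * (1 / x) + (- g x / \<kappa>) / u x) (at x)"
    using assms u_pos[OF assms] \<kappa>_pos
    by (auto intro!: derivative_eq_intros u_deriv simp: mult.commute)
  also have "(N - p) / \<kappa> * (1 / x) + (- g x / \<kappa>) / u x = E x / (\<kappa> * x * u x)"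
    using assms u_pos[OF assms] \<kappa>_pos by (simp add: E_def field_simps)
  finally show ?thesis
  proof (rule has_field_derivative_transform_within_open[where S = "{0<..}"])
    fix y :: real assume "y \<in> {0<..}"
    then show "(N - p) / \<kappa> * ln y + ln (u y) = ln (v y)"
      using u_pos[of y] by (simp add: v_def ln_mult ln_powr)
  qed (use assms in auto)
qed

lemma v_mono:
  assumes "0 < x" "x \<le> y"
  shows "v x \<le> v y"
proof -
  have "ln (v x) \<le> ln (v y)"
  proof (rule DERIV_nonneg_imp_nondecreasing[OF assms(2)])
    fix t assume "x \<le> t" "t \<le> y"
    then have "t > 0" using assms by simp
    then show "\<exists>D. ((\<lambda>x. ln (v x)) has_real_derivative D) (at t) \<and> 0 \<le> D"
      using ln_v_deriv[OF \<open>t > 0\<close>] E_pos[OF \<open>t > 0\<close>] u_pos[OF \<open>t > 0\<close>] \<kappa>_pos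
      by (intro exI[of _ "E t / (\<kappa> * t * u t)"]) auto
  qed
  then show ?thesis using assms v_pos by simp
qed

text \<open>Up to the positive factor \<open>\<kappa> x\<close>, \<open>ln v\<close> grows at rate \<open>e = E / u\<close>. The term \<open>m E / (x h)\<close>
  cancels this growth up to an error \<open>m N\<^sup>2 u / (x h)\<close>, which the last term absorbs since
  \<open>u / (x h)\<close> decays at least at the rate \<open>a p - 2\<close>.\<close>

definition \<Lambda> where
  "\<Lambda> x = ln (v x) + (m * E x + m * N\<^sup>2 / (a * p - 2) * u x) / (x * h x)"

lemma \<Lambda>_antimono:
  assumes "0 < x" "x \<le> y"
  shows "\<Lambda> y \<le> \<Lambda> x"
proof (rule DERIV_nonpos_imp_nonincreasing[OF assms(2)])
  fix t assume "x \<le> t" "t \<le> y"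
  then have t: "t > 0" using assms by simp
  have u: "0 < u t" "u t < 1" using t u_pos u_less_1 by auto
  define q where "q = a * p - 2"
  have q: "q > 0" using ap_gt_2 by (simp add: q_def)
  \<comment> \<open>Chosen so that \<open>K * q = m * N\<^sup>2\<close>, a bound for
    \<open>m * (\<psi> * (p + e))\<close>.\<close>
  define K where "K = m * N\<^sup>2 / q"
  have K: "K > 0" using q m_pos N_pos by (simp add: K_def)
  \<comment> \<open>Normalised forms of \<open>g\<close> and \<open>E\<close>: both are positive
    with sum \<open>N - p\<close>, and the sign of \<open>?D\<close> depends on them alone.\<close>
  define \<psi> where "\<psi> = t * g t / u t"
  define e where "e = E t / u t"
  have \<psi>e: "\<psi> + e = N - p" using u by (simp add: \<psi>_def e_def E_def field_simps)
  have pos: "\<psi> > 0" "e > 0" using t u g_pos E_pos by (auto simp: \<psi>_def e_def)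
  have gt: "g t = \<psi> * u t / t" and Et: "E t = e * u t" using t u by (auto simp: \<psi>_def e_def)
  have ht: "h t > 0" using h_pos[OF t] .
  let ?D = "E t / (\<kappa> * t * u t) +
     ((m * (p * g t / \<kappa> - h t * E t / (m * \<kappa> * u t)) + K * (- g t / \<kappa>)) * (t * h t) -
      (m * E t + K * u t) * (1 * h t + - (h t * g t / (m * \<kappa> * u t)) * t)) / ((t * h t) * (t * h t))"
  have "(\<Lambda> has_real_derivative ?D) (at t)"
    unfolding \<Lambda>_def[abs_def] q_def[symmetric] K_def[symmetric] using t ht
    by (intro DERIV_add ln_v_deriv DERIV_divide DERIV_cmult DERIV_mult DERIV_ident u_deriv
        E_deriv h_deriv u) auto
  moreover have "?D = u t / (\<kappa> * t\<^sup>2 * h t) *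
      (m * p * \<psi> - m * e * \<kappa> + e * \<psi> - K * (\<kappa> - a * \<psi>))"
    using t u ht \<kappa>_pos m_pos unfolding gt Et a_def
    by (simp add: field_simps power2_eq_square)
  moreover have "m * p * \<psi> - m * e * \<kappa> + e * \<psi> - K * (\<kappa> - a * \<psi>) \<le> 0"
  proof -
    \<comment> \<open>\<open>\<kappa> - a * \<psi>\<close> is \<open>\<kappa> * t\<close> times the
      logarithmic derivative of \<open>x * h x / u x\<close> at \<open>t\<close>, so this identity
      gives the decay rate of \<open>u x / (x * h x)\<close>.\<close>
    have kq: "\<kappa> - a * \<psi> = q + a * e"
    proof -
      have "a * (\<psi> + e) = a * (N - p)" by (simp only: \<psi>e)
      then show ?thesis by (simp add: \<kappa>_def q_def algebra_simps)
    qed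
    have m1: "m * a = 1 - m" using m_pos by (simp add: a_def field_simps)
    have "m * p * \<psi> - m * e * \<kappa> + e * \<psi> = m * (\<psi> * (p + e)) - m * e * (\<kappa> - a * \<psi>)"
    proof -
      have "m * (\<psi> * (p + e)) - m * e * (\<kappa> - a * \<psi>) = m * p * \<psi> - m * e * \<kappa> + (m * a + m) * (e * \<psi>)"
        by (simp add: algebra_simps)
      then show ?thesis unfolding m1 by simp
    qed
    also have "\<dots> \<le> m * (\<psi> * (p + e))"
      using m_pos pos q a_pos unfolding kq by simp
    also have "\<dots> \<le> m * (N * N)"
      using m_pos pos \<psi>e p_pos p_less_N by (intro mult_left_mono mult_mono) auto
    also have "m * (N * N) = K * q" using q by (simp add: K_def power2_eq_square)
    also have "\<dots> \<le> K * (\<kappa> - a * \<psi>)"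
      unfolding kq using K pos a_pos by (intro mult_left_mono) auto
    finally show ?thesis by simp
  qed
  then have "u t / (\<kappa> * t\<^sup>2 * h t) *
      (m * p * \<psi> - m * e * \<kappa> + e * \<psi> - K * (\<kappa> - a * \<psi>)) \<le> 0"
    using t u ht \<kappa>_pos by (intro mult_nonneg_nonpos) auto
  ultimately show "\<exists>D. (\<Lambda> has_real_derivative D) (at t) \<and> D \<le> 0" by metis
qed

text \<open>The correction in \<open>\<Lambda>\<close> is nonnegative, so \<open>\<Lambda>\<close>
  dominates \<open>ln v\<close>, and it does not increase after 1.\<close>

lemma v_bounded:
  assumes "x \<ge> 1"
  shows "v x \<le> exp (\<Lambda> 1)"
proof -
  have x: "x > 0" using assms by simp
  have "0 \<le> (m * E x + m * N\<^sup>2 / (a * p - 2) * u x) / (x * h x)"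
    using x m_pos E_pos[OF x] u_pos[OF x] h_pos[OF x] ap_gt_2 by (intro divide_nonneg_pos) auto
  then have "ln (v x) \<le> \<Lambda> x" by (simp add: \<Lambda>_def)
  also have "\<dots> \<le> \<Lambda> 1" using assms by (intro \<Lambda>_antimono) auto
  finally have "exp (ln (v x)) \<le> exp (\<Lambda> 1)" by simp
  then show ?thesis using v_pos[OF x] by simp
qed

lemma v_converges: "\<exists>V>0. (v \<longlongrightarrow> V) at_top"
proof -
  define V where "V = Sup (v ` {1..})"
  have bdd: "bdd_above (v ` {1..})" using v_bounded by (auto intro!: bdd_aboveI2)
  have le: "v x \<le> V" if "x \<ge> 1" for x
    unfolding V_def using that bdd by (intro cSUP_upper) auto
  have "(v \<longlongrightarrow> V) at_top"
  proof (rule order_tendstoI)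
    fix c assume "V < c"
    then have "v x < c" if "x \<ge> 1" for x using le[OF that] by simp
    then show "\<forall>\<^sub>F x in at_top. v x < c"
      using eventually_ge_at_top[of 1] by (rule eventually_mono[rotated])
  next
    fix c assume "c < V"
    then obtain y where y: "y \<ge> 1" "c < v y"
      unfolding V_def using bdd by (subst (asm) less_cSUP_iff) auto
    then have "c < v x" if "x \<ge> y" for x using v_mono[of y x] that by simp
    then show "\<forall>\<^sub>F x in at_top. c < v x"
      using eventually_ge_at_top[of y] by (rule eventually_mono[rotated])
  qed
  moreover have "V > 0" using le[of 1] v_pos[of 1] by simp
  ultimately show ?thesis by blast
qed

section \<open>From the profile in x back to the system in s = ln r\<close>

lemma profile_sol:
  "sol (\<lambda>s. exp (- N * s) * u (exp (- \<kappa> * s))) (\<lambda>s. - exp (- (N + \<kappa>) * s) * \<zeta> (exp (- \<kappa> * s)))"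
  unfolding sol_def
proof (intro allI conjI)
  fix s
  define x where "x = exp (- \<kappa> * s)"
  have x: "x > 0" by (simp add: x_def)
  show "0 < exp (- N * s) * u (exp (- \<kappa> * s))" using u_pos by simp
  have ex: "exp (- (N + \<kappa>) * s) = exp (- N * s) * x"
    by (simp add: x_def algebra_simps flip: exp_add)
  \<comment> \<open>The exponents combine by \<open>N_div_m\<close>, and the truncation is inactive
    because \<open>0 < u x\<close> and \<open>u x < 1\<close>.\<close>
  have f: "b * exp (2 * s) * (m * (exp (- N * s) * u x)) powr (1 / m) = exp (- N * s) * x * h x"
  proof -
    have "(m * (exp (- N * s) * u x)) powr (1 / m) = exp (- N * s) powr (1 / m) * (m * u x) powr (1 / m)"
      using m_pos u_pos[OF x] powr_mult[of "exp (- N * s)" "m * u x" "1 / m"]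
      by (simp add: mult.left_commute)
    moreover have "exp (2 * s) * exp (- N * s) powr (1 / m) = exp (- N * s) * x"
    proof -
      have "exp (- N * s) powr (1 / m) = exp (- (N / m) * s)" by (simp add: powr_def)
      then show ?thesis unfolding N_div_m x_def by (simp add: algebra_simps flip: exp_add)
    qed
    ultimately have "b * exp (2 * s) * (m * (exp (- N * s) * u x)) powr (1 / m) =
        (exp (- N * s) * x) * (b * (m * u x) powr (1 / m))"
      by (metis mult.assoc mult.left_commute)
    then show ?thesis using trunc_eq[of "u x"] u_pos[OF x] u_less_1[OF x] by (simp add: h_def)
  qed
  have dx: "((\<lambda>s. exp (- \<kappa> * s)) has_real_derivative - \<kappa> * x) (at s)"
    by (auto intro!: derivative_eq_intros simp: x_def)
  have du: "((\<lambda>s. u (exp (- \<kappa> * s))) has_real_derivative - g x / \<kappa> * (- \<kappa> * x)) (at s)"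
    using DERIV_chain2[OF u_deriv dx] x by (simp add: x_def)
  have dz: "((\<lambda>s. \<zeta> (exp (- \<kappa> * s))) has_real_derivative
      ((\<gamma> - 2) * h x - (N + \<kappa>) * \<zeta> x) / (\<kappa> * x) * (- \<kappa> * x)) (at s)"
    using DERIV_chain2[OF \<zeta>_trunc dx] x by (simp add: x_def h_def)
  have "((\<lambda>s. exp (- N * s) * u (exp (- \<kappa> * s))) has_real_derivative
      exp (- N * s) * (- N) * u x + (- g x / \<kappa> * (- \<kappa> * x)) * exp (- N * s)) (at s)"
    unfolding x_def
    by (intro DERIV_mult du[unfolded x_def]) (auto intro!: derivative_eq_intros)
  also have "exp (- N * s) * (- N) * u x + (- g x / \<kappa> * (- \<kappa> * x)) * exp (- N * s) =
      - exp (- (N + \<kappa>) * s) * \<zeta> x - N * (exp (- N * s) * u x)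
        + b * exp (2 * s) * (m * (exp (- N * s) * u x)) powr (1 / m)"
  proof -
    have e: "- g x / \<kappa> * (- \<kappa> * x) = x * (h x - \<zeta> x)" using \<kappa>_pos by (simp add: g_def field_simps)
    show ?thesis unfolding f ex e by (simp add: algebra_simps)
  qed
  finally show "((\<lambda>s. exp (- N * s) * u (exp (- \<kappa> * s))) has_real_derivative
      - exp (- (N + \<kappa>) * s) * \<zeta> (exp (- \<kappa> * s)) - N * (exp (- N * s) * u (exp (- \<kappa> * s)))
        + b * exp (2 * s) * (m * (exp (- N * s) * u (exp (- \<kappa> * s)))) powr (1 / m)) (at s)"
    unfolding x_def .
  have "((\<lambda>s. - exp (- (N + \<kappa>) * s) * \<zeta> (exp (- \<kappa> * s))) has_real_derivative
      (- (exp (- (N + \<kappa>) * s) * - (N + \<kappa>))) * \<zeta> x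
        + (((\<gamma> - 2) * h x - (N + \<kappa>) * \<zeta> x) / (\<kappa> * x) * (- \<kappa> * x)) * - exp (- (N + \<kappa>) * s)) (at s)"
    unfolding x_def
    by (intro DERIV_mult dz[unfolded x_def]) (auto intro!: derivative_eq_intros)
  also have "(- (exp (- (N + \<kappa>) * s) * - (N + \<kappa>))) * \<zeta> x
        + (((\<gamma> - 2) * h x - (N + \<kappa>) * \<zeta> x) / (\<kappa> * x) * (- \<kappa> * x)) * - exp (- (N + \<kappa>) * s) =
      (\<gamma> - 2) * (b * exp (2 * s) * (m * (exp (- N * s) * u x)) powr (1 / m))"
    unfolding f ex using \<kappa>_pos x by (simp add: field_simps)
  finally show "((\<lambda>s. - exp (- (N + \<kappa>) * s) * \<zeta> (exp (- \<kappa> * s))) has_real_derivative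
      b * (\<gamma> - 2) * exp (2 * s) * (m * (exp (- N * s) * u (exp (- \<kappa> * s)))) powr (1 / m)) (at s)"
    unfolding x_def by (simp add: mult_ac)
qed

text \<open>As \<open>s\<close> tends to minus infinity, \<open>x\<close> tends to infinity and the
  first limit is that of \<open>v\<close>; as \<open>s\<close> tends to infinity, \<open>x\<close>
  tends to 0 and the second limit is \<open>u 0\<close>.\<close>

lemma profile_limits:
  "\<exists>V>0. ((\<lambda>s. exp (p * s) * (exp (- N * s) * u (exp (- \<kappa> * s)))) \<longlongrightarrow> V) at_bot"
  "((\<lambda>s. exp (N * s) * (exp (- N * s) * u (exp (- \<kappa> * s)))) \<longlongrightarrow> 1) at_top"
proof -
  obtain V where V: "V > 0" "(v \<longlongrightarrow> V) at_top" using v_converges by blast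
  have "filterlim (\<lambda>s. exp (- \<kappa> * s)) at_top at_bot"
    using filterlim_tendsto_pos_mult_at_top[OF tendsto_const \<kappa>_pos filterlim_uminus_at_top_at_bot]
    by (intro filterlim_compose[OF exp_at_top]) simp
  from filterlim_compose[OF V(2) this]
  have "((\<lambda>s. v (exp (- \<kappa> * s))) \<longlongrightarrow> V) at_bot" .
  moreover have "v (exp (- \<kappa> * s)) = exp (p * s) * (exp (- N * s) * u (exp (- \<kappa> * s)))" for s
  proof -
    have "exp (- \<kappa> * s) powr ((N - p) / \<kappa>) = exp (p * s) * exp (- N * s)"
    proof -
      have "(N - p) / \<kappa> * (- \<kappa> * s) = p * s + - N * s"
        using \<kappa>_pos by (simp add: field_simps)
      then show ?thesis by (simp only: powr_def exp_not_eq_zero ln_exp if_False exp_add)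
    qed
    then show ?thesis by (simp add: v_def)
  qed
  ultimately show "\<exists>V>0. ((\<lambda>s. exp (p * s) * (exp (- N * s) * u (exp (- \<kappa> * s)))) \<longlongrightarrow> V) at_bot"
    using V(1) by auto
  have "filterlim (\<lambda>s. - \<kappa> * s) at_bot at_top"
    using \<kappa>_pos by (intro filterlim_tendsto_neg_mult_at_bot[OF tendsto_const])
      (auto intro: filterlim_ident)
  then have "((\<lambda>s. exp (- \<kappa> * s)) \<longlongrightarrow> 0) at_top"
    by (rule filterlim_compose[OF exp_at_bot])
  then have "filterlim (\<lambda>s. exp (- \<kappa> * s)) (at_right 0) at_top"
    by (simp add: filterlim_at)
  moreover have "(u \<longlongrightarrow> u 0) (at 0 within {0..})" using u_cont by (simp add: continuous_on_def)
  then have "(u \<longlongrightarrow> 1) (at_right 0)" unfolding u_0 by (rule tendsto_within_subset) auto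
  ultimately have "((\<lambda>s. u (exp (- \<kappa> * s))) \<longlongrightarrow> 1) at_top" by (rule filterlim_compose[rotated])
  then show "((\<lambda>s. exp (N * s) * (exp (- N * s) * u (exp (- \<kappa> * s)))) \<longlongrightarrow> 1) at_top"
    by (simp flip: mult.assoc exp_add)
qed

end

section \<open>Existence with a prescribed limit at the origin\<close>

context singular_system
begin

lemma sol_exists:
  assumes "V > 0"
  shows "\<exists>F z D. sol F z \<and> ((\<lambda>s. exp (p * s) * F s) \<longlongrightarrow> V) at_bot \<and>
    D > 0 \<and> ((\<lambda>s. exp (N * s) * F s) \<longlongrightarrow> D) at_top"
proof -
  obtain u \<zeta> where "singular_profile N b m \<gamma> u \<zeta>"
    using profile_exists singular_system_axioms
    unfolding singular_profile_def singular_profile_axioms_def by blast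
  then interpret singular_profile N b m \<gamma> u \<zeta> .
  define F where "F s = exp (- N * s) * u (exp (- \<kappa> * s))" for s
  obtain z where S: "sol F z" using profile_sol unfolding F_def by blast
  obtain W where W: "W > 0" "((\<lambda>s. exp (p * s) * F s) \<longlongrightarrow> W) at_bot"
    using profile_limits(1) unfolding F_def by blast
  have lim1: "((\<lambda>s. exp (N * s) * F s) \<longlongrightarrow> 1) at_top"
    using profile_limits(2) unfolding F_def .
  \<comment> \<open>The shift that carries the limit \<open>W\<close> of the constructed solution to
    \<open>V\<close>.\<close>
  define l where "l = ln (V / W) / (2 / a - p)"
  have "exp ((2 / a - p) * l) * W = V"
    using assms W(1) scale_exponent_neg by (simp add: l_def)
  then have "((\<lambda>s. exp (p * s) * (exp (2 * l / a) * F (s + l))) \<longlongrightarrow> V) at_bot"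
    using scaled_limit[OF W(2), of l] by simp
  moreover have "((\<lambda>s. exp (N * s) * (exp (2 * l / a) * F (s + l))) \<longlongrightarrow> exp (2 * l / a - N * l)) at_top"
  proof -
    have "filterlim (\<lambda>s. s + l) at_top at_top"
      by (rule filterlim_tendsto_add_at_top[OF tendsto_const filterlim_ident, of l, simplified add.commute])
    from tendsto_mult[OF tendsto_const[of "exp (2 * l / a - N * l)"] filterlim_compose[OF lim1 this]]
    have "((\<lambda>s. exp (2 * l / a - N * l) * (exp (N * (s + l)) * F (s + l))) \<longlongrightarrow>
        exp (2 * l / a - N * l) * 1) at_top" .
    moreover have "exp (2 * l / a - N * l) * (exp (N * (s + l)) * F (s + l)) =
        exp (N * s) * (exp (2 * l / a) * F (s + l))" for s
      by (simp add: exp_add exp_diff algebra_simps)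
    ultimately show ?thesis by simp
  qed
  ultimately show ?thesis using sol_scale[OF S, of l] exp_gt_zero by blast
qed

end

section \<open>Radial functions\<close>

lemma partial_eqI: "(f has_derivative f') (at x) \<Longrightarrow> partial b f x = f' b"
  unfolding partial_def by (simp add: frechet_derivative_at[symmetric])

lemma has_derivative_radial:
  fixes x :: "'a::euclidean_space"
  assumes "x \<noteq> 0" "(\<phi> has_real_derivative D) (at (norm x))"
  shows "((\<lambda>y. \<phi> (norm y)) has_derivative (\<lambda>h. D / norm x * (x \<bullet> h))) (at x)"
proof -
  have "(norm has_derivative (\<lambda>h. x \<bullet> h / norm x)) (at x)"
    using has_derivative_norm[OF assms(1)] by (simp add: sgn_div_norm inner_commute divide_inverse mult.commute)
  from has_derivative_compose[OF this assms(2)[unfolded has_field_derivative_def]]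
  show ?thesis by (simp add: mult.commute divide_inverse mult.left_commute)
qed

text \<open>Kept abstract because it is applied both to \<open>f\<close> and to
  \<open>f powr m / m\<close>.\<close>

locale radial_profile =
  fixes f :: "'a::euclidean_space \<Rightarrow> real" and \<phi> \<phi>' \<phi>'' :: "real \<Rightarrow> real"
  assumes f_eq: "\<And>x. x \<noteq> 0 \<Longrightarrow> f x = \<phi> (norm x)"
    and \<phi>_deriv: "\<And>r. r > 0 \<Longrightarrow> (\<phi> has_real_derivative \<phi>' r) (at r)"
    and \<phi>'_deriv: "\<And>r. r > 0 \<Longrightarrow> (\<phi>' has_real_derivative \<phi>'' r) (at r)"
begin

lemma f_has_derivative:
  "x \<noteq> 0 \<Longrightarrow> (f has_derivative (\<lambda>h. \<phi>' (norm x) / norm x * (x \<bullet> h))) (at x)"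
  by (rule has_derivative_transform_within_open[OF has_derivative_radial[OF _ \<phi>_deriv], of _ "- {0}"])
     (auto simp: f_eq)

lemma partial_f: "x \<noteq> 0 \<Longrightarrow> partial b f x = \<phi>' (norm x) / norm x * (x \<bullet> b)"
  by (rule partial_eqI[OF f_has_derivative])

lemma partial_f_has_derivative:
  assumes "x \<noteq> 0"
  shows "(partial b f has_derivative (\<lambda>h. (\<phi>'' (norm x) * norm x - \<phi>' (norm x)) / norm x ^ 3 * (x \<bullet> h) * (x \<bullet> b)
      + \<phi>' (norm x) / norm x * (h \<bullet> b))) (at x)"
proof -
  have r: "norm x > 0" using assms by simp
  have "((\<lambda>r. \<phi>' r / r) has_real_derivative
      (\<phi>'' (norm x) * norm x - \<phi>' (norm x)) / (norm x * norm x)) (at (norm x))"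
    using r by (auto intro!: derivative_eq_intros \<phi>'_deriv)
  from has_derivative_radial[OF assms this]
  have "((\<lambda>y. \<phi>' (norm y) / norm y * (y \<bullet> b)) has_derivative
     (\<lambda>h. \<phi>' (norm x) / norm x * (h \<bullet> b) +
       (\<phi>'' (norm x) * norm x - \<phi>' (norm x)) / (norm x * norm x) / norm x * (x \<bullet> h) * (x \<bullet> b))) (at x)"
    by (intro has_derivative_mult) (auto intro!: derivative_eq_intros)
  then have "((\<lambda>y. \<phi>' (norm y) / norm y * (y \<bullet> b)) has_derivative
     (\<lambda>h. (\<phi>'' (norm x) * norm x - \<phi>' (norm x)) / norm x ^ 3 * (x \<bullet> h) * (x \<bullet> b)
      + \<phi>' (norm x) / norm x * (h \<bullet> b))) (at x)"
    by (simp add: power3_eq_cube add.commute)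
  then show ?thesis
    by (rule has_derivative_transform_within_open[of _ _ _ _ "- {0}"]) (use assms in \<open>auto simp: partial_f\<close>)
qed

lemma partial_partial_f:
  "x \<noteq> 0 \<Longrightarrow> partial c (partial b f) x =
     (\<phi>'' (norm x) * norm x - \<phi>' (norm x)) / norm x ^ 3 * (x \<bullet> c) * (x \<bullet> b)
      + \<phi>' (norm x) / norm x * (c \<bullet> b)"
  by (rule partial_eqI[OF partial_f_has_derivative])

lemma laplacian_f:
  assumes "x \<noteq> 0"
  shows "laplacian f x = \<phi>'' (norm x) + (real DIM('a) - 1) / norm x * \<phi>' (norm x)"
proof -
  let ?r = "norm x"
  have sq: "(\<Sum>b\<in>Basis. (x \<bullet> b) * (x \<bullet> b)) = ?r\<^sup>2"
    by (simp add: power2_norm_eq_inner euclidean_inner[of x x])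
  have "laplacian f x = (\<Sum>b\<in>Basis. (\<phi>'' ?r * ?r - \<phi>' ?r) / ?r ^ 3 * ((x \<bullet> b) * (x \<bullet> b)) + \<phi>' ?r / ?r)"
    unfolding laplacian_def by (intro sum.cong) (auto simp: partial_partial_f assms inner_same_Basis)
  also have "\<dots> = (\<phi>'' ?r * ?r - \<phi>' ?r) / ?r ^ 3 * ?r\<^sup>2 + real DIM('a) * (\<phi>' ?r / ?r)"
    by (simp only: sum.distrib sum_constant sq flip: sum_distrib_left)
  also have "\<dots> = \<phi>'' ?r + (real DIM('a) - 1) / ?r * \<phi>' ?r"
    using assms by (simp add: field_simps power2_eq_square power3_eq_cube)
  finally show ?thesis .
qed

lemma inner_grad_f:
  assumes "x \<noteq> 0"
  shows "x \<bullet> grad f x = norm x * \<phi>' (norm x)"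
proof -
  have "x \<bullet> grad f x = (\<Sum>b\<in>Basis. \<phi>' (norm x) / norm x * ((x \<bullet> b) * (x \<bullet> b)))"
    unfolding grad_def by (simp add: inner_sum_right partial_f[OF assms] mult.assoc)
  also have "\<dots> = \<phi>' (norm x) / norm x * (norm x)\<^sup>2"
    by (simp only: power2_norm_eq_inner euclidean_inner[of x x] sum_distrib_left)
  finally show ?thesis using assms by (simp add: power2_eq_square)
qed

lemma Ck_on_2:
  assumes "continuous_on {0<..} \<phi>''"
  shows "Ck_on 2 f (- {0})"
proof -
  have "continuous_on {0<..} \<phi>'"
    using \<phi>'_deriv by (auto intro!: continuous_at_imp_continuous_on DERIV_isCont)
  then have cont: "continuous_on (- {0}) (\<lambda>x::'a. \<phi>' (norm x))" "continuous_on (- {0}) (\<lambda>x::'a. \<phi>'' (norm x))"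
    using assms by (auto intro!: continuous_on_compose2[of "{0<..}" _ "- {0}" norm] continuous_intros)
  have "continuous_on (- {0}) (partial c (partial b f))" for b c
  proof (rule continuous_on_eq)
    show "continuous_on (- {0::'a}) (\<lambda>x. (\<phi>'' (norm x) * norm x - \<phi>' (norm x)) / norm x ^ 3 * (x \<bullet> c) * (x \<bullet> b)
      + \<phi>' (norm x) / norm x * (c \<bullet> b))"
      by (intro continuous_intros cont) auto
  qed (auto simp: partial_partial_f)
  then show ?thesis
    using differentiableI[OF f_has_derivative] differentiableI[OF partial_f_has_derivative]
    by (simp add: numeral_2_eq_2)
qed

end

text \<open>The profile is the restriction of \<open>f\<close> to the ray through a basis vector
  \<open>e\<close>; its derivatives are the iterated partial derivatives in direction
  \<open>e\<close>.\<close>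

lemma radial_profile_exists:
  fixes f :: "'a::euclidean_space \<Rightarrow> real"
  assumes C2: "Ck_on 2 f (- {0})" and "radially_symmetric f"
  shows "\<exists>\<phi> \<phi>' \<phi>''. radial_profile f \<phi> \<phi>' \<phi>''"
proof -
  obtain g where g: "\<And>x. x \<noteq> 0 \<Longrightarrow> f x = g (norm x)"
    using assms(2) unfolding radially_symmetric_def by blast
  obtain e :: 'a where e: "e \<in> Basis" using nonempty_Basis by blast
  have along: "((\<lambda>r. k (r *\<^sub>R e)) has_real_derivative partial e k (r *\<^sub>R e)) (at r)"
    if diff: "k differentiable (at (r *\<^sub>R e))" for k :: "'a \<Rightarrow> real" and r
  proof -
    obtain k' where k': "(k has_derivative k') (at (r *\<^sub>R e))" using diff by (auto simp: differentiable_def)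
    have "((\<lambda>r. r *\<^sub>R e) has_derivative (\<lambda>h. h *\<^sub>R e)) (at r)" by (auto intro!: derivative_eq_intros)
    from has_derivative_compose[OF this k']
    have "((\<lambda>r. k (r *\<^sub>R e)) has_derivative (\<lambda>h. k' (h *\<^sub>R e))) (at r)" .
    moreover have "k' (h *\<^sub>R e) = partial e k (r *\<^sub>R e) * h" for h
      using linear_scale[OF has_derivative_linear[OF k']] partial_eqI[OF k', of e] by simp
    ultimately show ?thesis by (simp add: has_field_derivative_def)
  qed
  have "radial_profile f (\<lambda>r. f (r *\<^sub>R e)) (\<lambda>r. partial e f (r *\<^sub>R e))
      (\<lambda>r. partial e (partial e f) (r *\<^sub>R e))"
  proof
    show "f x = f (norm x *\<^sub>R e)" if "x \<noteq> 0" for x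
    proof -
      have "norm x *\<^sub>R e \<noteq> 0" using that e nonzero_Basis by auto
      then show ?thesis using g[OF that] g[of "norm x *\<^sub>R e"] e by simp
    qed
    fix r :: real assume "r > 0"
    then have "r *\<^sub>R e \<in> - {0}" using e by auto
    then show "((\<lambda>r. f (r *\<^sub>R e)) has_real_derivative partial e f (r *\<^sub>R e)) (at r)"
      and "((\<lambda>r. partial e f (r *\<^sub>R e)) has_real_derivative partial e (partial e f) (r *\<^sub>R e)) (at r)"
      using C2 e by (auto simp: numeral_2_eq_2 intro!: along)
  qed
  then show ?thesis by blast
qed

section \<open>The radial elliptic equation and the system are equivalent\<close>

context singular_system
begin

text \<open>The coefficient \<open>N + 1\<close> is the dimension minus one, from the radial
  Laplacian.\<close>

lemma radial_equation:
  fixes f :: "'a::euclidean_space \<Rightarrow> real"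
  assumes dim: "real DIM('a) = N + 2"
    and f: "radial_profile f \<phi> \<phi>' \<phi>''"
    and \<Psi>: "radial_profile (\<lambda>x. f x powr m / m) \<Psi> \<Psi>' \<Psi>''" and "x \<noteq> 0"
  shows "laplacian (\<lambda>y. f y powr m / m) x + - b * \<gamma> * f x + - b * (x \<bullet> grad f x) =
    \<Psi>'' (norm x) + (N + 1) / norm x * \<Psi>' (norm x)
      - b * (\<gamma> * \<phi> (norm x) + norm x * \<phi>' (norm x))"
  using radial_profile.laplacian_f[OF \<Psi> \<open>x \<noteq> 0\<close>] radial_profile.inner_grad_f[OF f \<open>x \<noteq> 0\<close>]
    radial_profile.f_eq[OF f \<open>x \<noteq> 0\<close>] dim
  by (simp add: algebra_simps)

lemma sol_of_elliptic:
  fixes f :: "'a::euclidean_space \<Rightarrow> real"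
  assumes dim: "real DIM('a) = N + 2"
    and ell: "elliptic_solution m (- b * \<gamma>) (- b) f" and rad: "radially_symmetric f"
  shows "\<exists>F z. sol F z \<and> (\<forall>x. x \<noteq> 0 \<longrightarrow> F (ln (norm x)) = f x powr m / m)"
proof -
  obtain \<phi> \<phi>' \<phi>'' where prof: "radial_profile f \<phi> \<phi>' \<phi>''"
    using radial_profile_exists[OF _ rad] ell unfolding elliptic_solution_def by blast
  interpret radial_profile f \<phi> \<phi>' \<phi>'' by fact
  obtain e :: 'a where e: "norm e = 1" using nonempty_Basis norm_Basis by blast
  have \<phi>_pos: "\<phi> r > 0" if "r > 0" for r
  proof -
    have "r *\<^sub>R e \<noteq> 0" using that e by auto
    then have "f (r *\<^sub>R e) > 0" using ell unfolding elliptic_solution_def by blast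
    then show ?thesis using f_eq[OF \<open>r *\<^sub>R e \<noteq> 0\<close>] that e by simp
  qed
  define \<Psi> where "\<Psi> r = \<phi> r powr m / m" for r
  define \<Psi>' where "\<Psi>' r = \<phi> r powr (m - 1) * \<phi>' r" for r
  define \<Psi>'' where "\<Psi>'' r = (m - 1) * \<phi> r powr (m - 2) * \<phi>' r * \<phi>' r + \<phi> r powr (m - 1) * \<phi>'' r" for r
  have \<Psi>_deriv: "(\<Psi> has_real_derivative \<Psi>' r) (at r)" if "r > 0" for r
    unfolding \<Psi>_def[abs_def] \<Psi>'_def using \<phi>_pos[OF that] m_pos that
    by (auto intro!: derivative_eq_intros \<phi>_deriv)
  have \<Psi>'_deriv: "(\<Psi>' has_real_derivative \<Psi>'' r) (at r)" if "r > 0" for r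
    unfolding \<Psi>'_def[abs_def] \<Psi>''_def using \<phi>_pos[OF that] that
    by (auto intro!: derivative_eq_intros \<phi>_deriv \<phi>'_deriv)
  have \<Psi>: "radial_profile (\<lambda>x. f x powr m / m) \<Psi> \<Psi>' \<Psi>''"
    by unfold_locales (auto simp: f_eq \<Psi>_def[symmetric] \<Psi>_deriv \<Psi>'_deriv)
  have ode: "\<Psi>'' r + (N + 1) / r * \<Psi>' r = b * (\<gamma> * \<phi> r + r * \<phi>' r)" if "r > 0" for r
  proof -
    have ne: "r *\<^sub>R e \<noteq> 0" and r: "norm (r *\<^sub>R e) = r" using that e by auto
    have "laplacian (\<lambda>y. f y powr m / m) (r *\<^sub>R e) + - b * \<gamma> * f (r *\<^sub>R e)
        + - b * ((r *\<^sub>R e) \<bullet> grad f (r *\<^sub>R e)) = 0"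
      using ell ne unfolding elliptic_solution_def by blast
    then show ?thesis unfolding radial_equation[OF dim prof \<Psi> ne] r by simp
  qed
  define F where "F s = \<Psi> (exp s)" for s
  define z where "z s = exp s * \<Psi>' (exp s) + N * F s - b * exp (2 * s) * \<phi> (exp s)" for s
  have F_root: "(m * F s) powr (1 / m) = \<phi> (exp s)" for s
    using m_pos \<phi>_pos[of "exp s"] by (simp add: F_def \<Psi>_def powr_powr)
  have F': "(F has_real_derivative exp s * \<Psi>' (exp s)) (at s)" for s
    unfolding F_def[abs_def] using DERIV_chain2[OF \<Psi>_deriv DERIV_exp, of s] by (simp add: mult.commute)
  have "sol F z"
    unfolding sol_def F_root
  proof (intro allI conjI)
    fix s
    show "0 < F s" using \<phi>_pos[of "exp s"] m_pos by (simp add: F_def \<Psi>_def)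
    show "(F has_real_derivative z s - N * F s + b * exp (2 * s) * \<phi> (exp s)) (at s)"
      using F' by (simp add: z_def)
    let ?d = "exp s * \<Psi>' (exp s) + \<Psi>'' (exp s) * exp s * exp s + N * (exp s * \<Psi>' (exp s))
        - (b * (exp (2 * s) * 2) * \<phi> (exp s) + \<phi>' (exp s) * exp s * (b * exp (2 * s)))"
    have "(z has_real_derivative ?d) (at s)"
      unfolding z_def[abs_def]
      by (intro DERIV_diff DERIV_add DERIV_mult DERIV_cmult DERIV_exp F'
          DERIV_chain2[OF \<Psi>'_deriv DERIV_exp] DERIV_chain2[OF \<phi>_deriv DERIV_exp])
         (auto intro!: derivative_eq_intros)
    \<comment> \<open>After multiplication of \<open>ode\<close> by r^2 the terms with
      \<open>\<phi>'\<close> cancel; the 2 in \<open>\<gamma> - 2\<close> comes from differentiating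
      \<open>exp (2 * s)\<close>.\<close>
    moreover have "?d = b * (\<gamma> - 2) * exp (2 * s) * \<phi> (exp s)"
    proof -
      have "exp (2 * s) = exp s * exp s" by (simp flip: exp_add)
      moreover have "exp s * exp s * (\<Psi>'' (exp s) + (N + 1) / exp s * \<Psi>' (exp s)) =
          exp s * exp s * (b * (\<gamma> * \<phi> (exp s) + exp s * \<phi>' (exp s)))"
        by (subst ode) auto
      moreover have "exp s * exp s * ((N + 1) / exp s * \<Psi>' (exp s)) = (N + 1) * (exp s * \<Psi>' (exp s))"
        by simp
      ultimately show ?thesis by (simp add: algebra_simps)
    qed
    ultimately show "(z has_real_derivative b * (\<gamma> - 2) * exp (2 * s) * \<phi> (exp s)) (at s)" by simp
  qed
  moreover have "F (ln (norm x)) = f x powr m / m" if "x \<noteq> 0" for x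
    using that by (simp add: F_def \<Psi>_def f_eq)
  ultimately show ?thesis by blast
qed

lemma elliptic_of_sol:
  assumes dim: "real DIM('a::euclidean_space) = N + 2" and S: "sol F z"
  defines "f \<equiv> \<lambda>x::'a. (m * F (ln (norm x))) powr (1 / m)"
  shows "elliptic_solution m (- b * \<gamma>) (- b) f"
proof -
  \<comment> \<open>In the variable \<open>s\<close>, \<open>y\<close> is \<open>f\<close> and
    \<open>P\<close> is the derivative of \<open>F\<close>. The system expresses all further
    derivatives algebraically through \<open>F\<close>, \<open>P\<close> and \<open>y\<close>, so
    continuity of the second derivative comes for free.\<close>
  define y where "y s = (m * F s) powr (1 / m)" for s
  define P where "P s = z s - N * F s + b * exp (2 * s) * y s" for s
  define y' where "y' s = y s * P s / (m * F s)" for s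
  define P' where "P' s = b * (\<gamma> - 2) * exp (2 * s) * y s - N * P s + b * (2 * exp (2 * s) * y s + exp (2 * s) * y' s)" for s
  define y'' where "y'' s = ((y' s * P s + y s * P' s) * (m * F s) - y s * P s * (m * P s)) / (m * F s)\<^sup>2" for s
  have Fp: "F s > 0" for s using sol_pos[OF S] .
  have F': "(F has_real_derivative P s) (at s)" for s
    using sol_F[OF S] by (simp add: P_def y_def)
  have z': "(z has_real_derivative b * (\<gamma> - 2) * exp (2 * s) * y s) (at s)" for s
    using sol_z[OF S] by (simp add: y_def)
  have y_deriv: "(y has_real_derivative y' s) (at s)" for s
  proof -
    have "(y has_real_derivative 1 / m * (m * F s) powr (1 / m - 1) * (m * P s)) (at s)"
      unfolding y_def[abs_def] using Fp[of s] m_pos by (auto intro!: derivative_eq_intros F')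
    also have "1 / m * (m * F s) powr (1 / m - 1) * (m * P s) = y' s"
      using Fp[of s] m_pos by (simp add: y'_def y_def powr_diff)
    finally show ?thesis .
  qed
  have P_deriv: "(P has_real_derivative P' s) (at s)" for s
    unfolding P_def[abs_def] P'_def
    by (rule DERIV_cong, (rule derivative_intros z' F' y_deriv)+) (simp add: P_def algebra_simps)
  have y'_deriv: "(y' has_real_derivative y'' s) (at s)" for s
    unfolding y'_def[abs_def] y''_def using Fp[of s] m_pos
    by (auto intro!: derivative_eq_intros y_deriv P_deriv F' simp: y'_def power2_eq_square)
  have cont: "continuous_on UNIV F" "continuous_on UNIV P" "continuous_on UNIV y" "continuous_on UNIV y'"
    using F' P_deriv y_deriv y'_deriv
    by (meson DERIV_isCont continuous_at_imp_continuous_on)+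
  have "continuous_on UNIV y''"
    unfolding y''_def P'_def using Fp m_pos
    by (intro continuous_intros cont) (simp add: less_imp_neq[symmetric])
  \<comment> \<open>The same derivatives in the variable \<open>r = exp s\<close>.\<close>
  define \<phi> where "\<phi> r = y (ln r)" for r
  define \<phi>' where "\<phi>' r = y' (ln r) / r" for r
  define \<phi>'' where "\<phi>'' r = (y'' (ln r) - y' (ln r)) / r\<^sup>2" for r
  define \<Psi> where "\<Psi> r = F (ln r)" for r
  define \<Psi>' where "\<Psi>' r = P (ln r) / r" for r
  define \<Psi>'' where "\<Psi>'' r = (P' (ln r) - P (ln r)) / r\<^sup>2" for r
  have log1: "((\<lambda>r. G (ln r)) has_real_derivative G' (ln r) / r) (at r)"
    if "\<And>s. (G has_real_derivative G' s) (at s)" "r > 0" for G G' :: "real \<Rightarrow> real" and r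
    using DERIV_chain2[OF that(1) DERIV_ln[OF that(2)]] by (simp add: divide_inverse)
  have log2: "((\<lambda>r. G (ln r) / r) has_real_derivative (G' (ln r) - G (ln r)) / r\<^sup>2) (at r)"
    if "\<And>s. (G has_real_derivative G' s) (at s)" "r > 0" for G G' :: "real \<Rightarrow> real" and r
    by (rule DERIV_cong[OF DERIV_divide[OF log1[OF that] DERIV_ident]])
       (use that(2) in \<open>auto simp: power2_eq_square\<close>)
  have prof: "radial_profile f \<phi> \<phi>' \<phi>''"
    by unfold_locales
       (auto simp: f_def \<phi>_def[abs_def] \<phi>'_def[abs_def] \<phi>''_def y_def[symmetric]
         intro!: log1 log2 y_deriv y'_deriv)
  have fp: "f x > 0" for x using Fp m_pos by (simp add: f_def less_imp_neq[symmetric])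
  have f_powr: "f x powr m / m = F (ln (norm x))" for x
    using m_pos Fp[of "ln (norm x)"] by (simp add: f_def powr_powr)
  have \<Psi>: "radial_profile (\<lambda>x. f x powr m / m) \<Psi> \<Psi>' \<Psi>''"
    unfolding f_powr
    by unfold_locales (auto simp: \<Psi>_def[abs_def] \<Psi>'_def[abs_def] \<Psi>''_def intro!: log1 log2 F' P_deriv)
  have "laplacian (\<lambda>y. f y powr m / m) x + - b * \<gamma> * f x + - b * (x \<bullet> grad f x) = 0" if "x \<noteq> 0" for x
  proof -
    define s where "s = ln (norm x)"
    have r: "norm x = exp s" using that by (simp add: s_def)
    have "\<Psi>'' (norm x) + (N + 1) / norm x * \<Psi>' (norm x) = (P' s + N * P s) / (exp s)\<^sup>2"
      by (simp add: \<Psi>''_def \<Psi>'_def r field_simps power2_eq_square)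
    also have "P' s + N * P s = exp (2 * s) * (b * (\<gamma> * y s + y' s))"
      by (simp add: P'_def algebra_simps)
    also have "exp (2 * s) * (b * (\<gamma> * y s + y' s)) / (exp s)\<^sup>2 = b * (\<gamma> * y s + y' s)"
      by (simp add: exp_double)
    also have "\<dots> = b * (\<gamma> * \<phi> (norm x) + norm x * \<phi>' (norm x))"
      by (simp add: \<phi>_def \<phi>'_def r)
    finally show ?thesis using radial_equation[OF dim prof \<Psi> that] by simp
  qed
  moreover have "Ck_on 2 f (- {0})"
    unfolding \<phi>''_def[abs_def]
    by (rule radial_profile.Ck_on_2[OF prof], unfold \<phi>''_def,
        intro continuous_intros continuous_on_compose2[OF \<open>continuous_on UNIV y''\<close>]
          continuous_on_compose2[OF cont(4)]) auto
  ultimately show ?thesis using fp by (simp add: elliptic_solution_def)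
qed

text \<open>Converts limits of \<open>F\<close> into limits of \<open>f\<close>: with
  \<open>k = p\<close> at the origin, where \<open>p / m = \<gamma>\<close>, and with
  \<open>k = N\<close> at infinity.\<close>

lemma root_scaled_limit:
  assumes "((\<lambda>s. exp (k * s) * F s) \<longlongrightarrow> V) G" and "V > 0"
    and "filterlim (\<lambda>x::'a::euclidean_space. ln (norm x)) G H" and "\<forall>\<^sub>F x in H. x \<noteq> 0" and "\<And>s. F s > 0"
  shows "((\<lambda>x. norm x powr (k / m) * (m * F (ln (norm x))) powr (1 / m)) \<longlongrightarrow> (m * V) powr (1 / m)) H"
proof -
  have "((\<lambda>x. (m * (exp (k * ln (norm x)) * F (ln (norm x)))) powr (1 / m)) \<longlongrightarrow> (m * V) powr (1 / m)) H"
    using m_pos \<open>V > 0\<close> by (intro tendsto_intros filterlim_compose[OF assms(1,3)]) auto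
  moreover have "\<forall>\<^sub>F x in H. (m * (exp (k * ln (norm x)) * F (ln (norm x)))) powr (1 / m) =
      norm x powr (k / m) * (m * F (ln (norm x))) powr (1 / m)"
    using assms(4)
  proof eventually_elim
    case (elim x)
    have "(m * (exp (k * ln (norm x)) * F (ln (norm x)))) powr (1 / m) =
        exp (k * ln (norm x)) powr (1 / m) * (m * F (ln (norm x))) powr (1 / m)"
      using m_pos assms(5)[of "ln (norm x)"] powr_mult[of "exp (k * ln (norm x))" "m * F (ln (norm x))" "1 / m"]
      by (simp add: mult.left_commute)
    also have "exp (k * ln (norm x)) powr (1 / m) = norm x powr (k / m)"
      using elim by (simp add: powr_def)
    finally show ?case .
  qed
  ultimately show ?thesis by (rule Lim_transform_eventually)
qed

lemma ln_norm_at_0: "filterlim (\<lambda>x::'a::euclidean_space. ln (norm x)) at_bot (at 0)"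
proof (rule filterlim_compose[OF ln_at_0])
  show "filterlim (norm :: 'a \<Rightarrow> real) (at_right 0) (at 0)"
    by (auto simp: filterlim_at eventually_at_filter intro!: tendsto_norm_zero tendsto_ident_at)
qed

lemma singular_limit_imp:
  fixes f :: "'a::euclidean_space \<Rightarrow> real"
  assumes lim: "((\<lambda>x. norm x powr \<gamma> * f x) \<longlongrightarrow> \<eta>) (at 0)" and "\<eta> > 0"
    and F: "\<And>x. x \<noteq> 0 \<Longrightarrow> F (ln (norm x)) = f x powr m / m" and f: "\<And>x. x \<noteq> 0 \<Longrightarrow> f x > 0"
  shows "((\<lambda>s. exp (p * s) * F s) \<longlongrightarrow> \<eta> powr m / m) at_bot"
proof -
  obtain e :: 'a where e: "norm e = 1" using nonempty_Basis norm_Basis by blast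
  \<comment> \<open>Approaching the origin along one ray suffices, because \<open>F\<close> depends
    only on the norm.\<close>
  have "filterlim (\<lambda>s. exp s *\<^sub>R e) (at 0) at_bot"
    unfolding filterlim_at
  proof
    have "((\<lambda>s. exp s *\<^sub>R e) \<longlongrightarrow> 0 *\<^sub>R e) at_bot"
      by (intro tendsto_intros exp_at_bot)
    then show "((\<lambda>s. exp s *\<^sub>R e) \<longlongrightarrow> 0) at_bot" by simp
  qed (use e in auto)
  from filterlim_compose[OF lim this]
  have "((\<lambda>s. exp s powr \<gamma> * f (exp s *\<^sub>R e)) \<longlongrightarrow> \<eta>) at_bot" using e by simp
  then have "((\<lambda>s. (exp s powr \<gamma> * f (exp s *\<^sub>R e)) powr m / m) \<longlongrightarrow> \<eta> powr m / m) at_bot"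
    using \<open>\<eta> > 0\<close> m_pos by (intro tendsto_intros) auto
  moreover have "(exp s powr \<gamma> * f (exp s *\<^sub>R e)) powr m / m = exp (p * s) * F s" for s
  proof -
    have ne: "exp s *\<^sub>R e \<noteq> 0" using e by auto
    have "F s = f (exp s *\<^sub>R e) powr m / m" using F[OF ne] e by simp
    moreover have "(exp s powr \<gamma>) powr m = exp (p * s)"
      by (simp add: powr_def p_def mult_ac)
    ultimately show ?thesis using f[OF ne] by (simp add: powr_mult)
  qed
  ultimately show ?thesis by simp
qed

lemma radial_problem:
  assumes dim: "real DIM('a::euclidean_space) = N + 2" and "\<eta> > 0"
  shows "\<exists>f :: 'a \<Rightarrow> real.
    (elliptic_solution m (- b * \<gamma>) (- b) f \<and> radially_symmetric f \<and>
      ((\<lambda>x. norm x powr \<gamma> * f x) \<longlongrightarrow> \<eta>) (at 0)) \<and>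
    (\<forall>g :: 'a \<Rightarrow> real.
      elliptic_solution m (- b * \<gamma>) (- b) g \<and> radially_symmetric g \<and>
      ((\<lambda>x. norm x powr \<gamma> * g x) \<longlongrightarrow> \<eta>) (at 0) \<longrightarrow>
      (\<forall>x. x \<noteq> 0 \<longrightarrow> g x = f x)) \<and>
    (\<exists>D>0. ((\<lambda>x. norm x powr (N / m) * f x) \<longlongrightarrow> D) at_infinity)"
proof -
  \<comment> \<open>The limit of r^p F that corresponds to the limit \<open>\<eta>\<close> for
    \<open>f\<close>.\<close>
  define V where "V = \<eta> powr m / m"
  have V: "V > 0" "(m * V) powr (1 / m) = \<eta>"
    using \<open>\<eta> > 0\<close> m_pos by (auto simp: V_def powr_powr)
  obtain F z D where S: "sol F z" and F0: "((\<lambda>s. exp (p * s) * F s) \<longlongrightarrow> V) at_bot"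
    and D: "D > 0" and F1: "((\<lambda>s. exp (N * s) * F s) \<longlongrightarrow> D) at_top"
    using sol_exists[OF V(1)] by blast
  define f where "f x = (m * F (ln (norm x))) powr (1 / m)" for x :: 'a
  have "elliptic_solution m (- b * \<gamma>) (- b) f"
    unfolding f_def[abs_def] by (rule elliptic_of_sol[OF dim S])
  moreover have "radially_symmetric f"
    unfolding radially_symmetric_def by (intro exI[of _ "\<lambda>r. (m * F (ln r)) powr (1 / m)"]) (simp add: f_def)
  moreover have "((\<lambda>x. norm x powr \<gamma> * f x) \<longlongrightarrow> \<eta>) (at 0)"
    using root_scaled_limit[OF F0 V(1) ln_norm_at_0 eventually_neq_at_within sol_pos[OF S]] m_pos
    by (simp add: f_def V(2) p_def)
  moreover have "g x = f x"
    if g: "elliptic_solution m (- b * \<gamma>) (- b) g" "radially_symmetric g"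
      "((\<lambda>x. norm x powr \<gamma> * g x) \<longlongrightarrow> \<eta>) (at 0)" and "x \<noteq> 0" for g and x :: 'a
  proof -
    have gp: "g x > 0" if "x \<noteq> 0" for x using g(1) that by (auto simp: elliptic_solution_def)
    obtain G w where T: "sol G w" and G: "\<And>x. x \<noteq> 0 \<Longrightarrow> G (ln (norm x)) = g x powr m / m"
      using sol_of_elliptic[OF dim g(1,2)] by blast
    have G0: "((\<lambda>s. exp (p * s) * G s) \<longlongrightarrow> V) at_bot"
      unfolding V_def by (rule singular_limit_imp[OF g(3) \<open>\<eta> > 0\<close> G gp])
    \<comment> \<open>Both solutions have the same limit \<open>V\<close>, so \<open>sol_le\<close>
      applies in both directions.\<close>
    have "G s = F s" for s
      using sol_le[OF S T V(1) F0 G0, of s] sol_le[OF T S V(1) G0 F0, of s] by simp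
    then have "m * F (ln (norm x)) = g x powr m" using G[OF \<open>x \<noteq> 0\<close>] m_pos by simp
    then show ?thesis using gp[OF \<open>x \<noteq> 0\<close>] m_pos by (simp add: f_def powr_powr)
  qed
  moreover have "((\<lambda>x. norm x powr (N / m) * f x) \<longlongrightarrow> (m * D) powr (1 / m)) at_infinity"
    unfolding f_def
  proof (rule root_scaled_limit[OF F1 D _ _ sol_pos[OF S]])
    show "filterlim (\<lambda>x::'a. ln (norm x)) at_top at_infinity"
      by (rule filterlim_compose[OF ln_at_top filterlim_norm_at_top])
    show "\<forall>\<^sub>F x::'a in at_infinity. x \<noteq> 0"
      by (rule eventually_at_infinityI[of 1]) auto
  qed
  moreover have "(m * D) powr (1 / m) > 0" using D m_pos by simp
  ultimately show ?thesis by blast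
qed

end

theorem theorem1p1:
  fixes m \<eta> \<alpha> \<beta> \<rho>\<^sub>1 :: real
  assumes "CARD('n::finite) \<ge> 3"
    and "0 < m" and "m < (real CARD('n) - 2) / real CARD('n)"
    and "\<eta> > 0"
    and "\<beta> < 0" and "\<rho>\<^sub>1 > 0"
    and "\<alpha> = (2 * \<beta> - \<rho>\<^sub>1) / (1 - m)"
    and "2 / (1 - m) < \<alpha> / \<beta>" and "\<alpha> / \<beta> < (real CARD('n) - 2) / m"
  shows "\<exists>f :: real ^ 'n \<Rightarrow> real.
    (elliptic_solution m \<alpha> \<beta> f \<and> radially_symmetric f \<and>
      ((\<lambda>x. norm x powr (\<alpha> / \<beta>) * f x) \<longlongrightarrow> \<eta>) (at 0)) \<and>
    (\<forall>g :: real ^ 'n \<Rightarrow> real.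
      elliptic_solution m \<alpha> \<beta> g \<and> radially_symmetric g \<and>
      ((\<lambda>x. norm x powr (\<alpha> / \<beta>) * g x) \<longlongrightarrow> \<eta>) (at 0) \<longrightarrow>
      (\<forall>x. x \<noteq> 0 \<longrightarrow> g x = f x)) \<and>
    (\<exists>D>0. ((\<lambda>x. norm x powr ((real CARD('n) - 2) / m) * f x) \<longlongrightarrow> D) at_infinity)"
proof -
  have "m < 1"
  proof -
    have "(real CARD('n) - 2) / real CARD('n) < 1" using assms(1) by simp
    then show ?thesis using assms(3) by linarith
  qed
  \<comment> \<open>With \<open>b = - \<beta>\<close> and
    \<open>\<gamma> = \<alpha> / \<beta>\<close> the coefficient \<open>- b * \<gamma>\<close> is
    \<open>\<alpha>\<close>, because \<open>\<beta>\<close> is nonzero.\<close>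
  then interpret singular_system "real CARD('n) - 2" "- \<beta>" m "\<alpha> / \<beta>"
    using assms by unfold_locales auto
  have "real DIM(real ^ 'n) = real CARD('n) - 2 + 2" by simp
  from radial_problem[OF this \<open>\<eta> > 0\<close>] show ?thesis using \<open>\<beta> < 0\<close> by simp
qed

end
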